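(* There are constants $c, C, C'>0$ such that for every $0<\beta<1/14$ there is $n_0=n_0(\beta)$ with the following property. For every integer $n\ge n_0$ there exists a triangle-free graph $G_n$ with $v(G_n)\in[n/3,n]$ vertices such that $$c\sqrt{\beta n\log n}\ \le\ \delta(G_n)\ \le\ \Delta(G_n)\ \le\ C\sqrt{\beta n\log n},$$ and such that every induced bipartite subgraph $F\subseteq G_n$ has minimum degree $\delta(F)\le C'\log n$.
   Context: Graphs are finite and simple; $v(G)$ is the number of vertices of $G$, and $\delta(G)$, $\Delta(G)$ denote the minimum and maximum degree of $G$. *)

theory Defs
  imports Complex_Main "Graph_Theory.Graph_Theory"
begin

text \<open>
  A finite simple graph is a symmetric, loop-free, finite digraph without multiple arcs
  (\<^locale>\<open>graph\<close>, or \<^locale>\<open>pair_graph\<close> when arcs are pairs of vertices): each edge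
  is represented by its two opposite arcs, so the degree of a vertex is its out-degree.
  The minimum and maximum degree are meaningful only for nonempty vertex sets.
\<close>

definition min_degree :: "('a, 'b) pre_digraph \<Rightarrow> nat" where
  "min_degree G = Min (out_degree G ` verts G)"

definition max_degree :: "('a, 'b) pre_digraph \<Rightarrow> nat" where
  "max_degree G = Max (out_degree G ` verts G)"

definition triangle_free :: "('a, 'b) pre_digraph \<Rightarrow> bool" where
  "triangle_free G \<longleftrightarrow>
    \<not> (\<exists>u v w. u \<rightarrow>\<^bsub>G\<^esub> v \<and> v \<rightarrow>\<^bsub>G\<^esub> w \<and> w \<rightarrow>\<^bsub>G\<^esub> u)"

definition bipartite :: "('a, 'b) pre_digraph \<Rightarrow> bool" where
  "bipartite G \<longleftrightarrow>
    (\<exists>U V. verts G = U \<union> V \<and> U \<inter> V = {} \<and> arcs_ends G \<subseteq> U \<times> V \<union> V \<times> U)"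

end

theory Submission
  imports Defs "HOL-Real_Asymp.Real_Asymp"
begin

text \<open>
  The graph grows one vertex at a time: the neighbourhood of a new vertex is a random independent
  set of the current graph, so no triangle ever arises. With \<open>p = sqrt (\<epsilon> ln n / n)\<close> the independent
  set should contain every old vertex with probability \<open>p\<close>. It is produced by a random greedy process
  on the set \<open>U\<close> of vertices that may still be picked. Picking \<open>z\<close> removes \<open>z\<close> and its neighbours from
  \<open>U\<close>; in addition vertices of \<open>U\<close> die spontaneously, at a rate that makes the probability of leaving \<open>U\<close>
  exactly the same for all of them. Hence the irregularities of the graph do not feed back into the
  process, \<open>|S \<inter> U|\<close> has the exact drift \<open>- h |S \<inter> U|\<close> for every set \<open>S\<close>, and \<open>|I \<inter> S|\<close> has exponential
  moments comparable to those of a \<open>p\<close>-random set \<open>I\<close> as soon as codegrees are small.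

  A potential function keeps all degrees of order \<open>p n\<close>, all codegrees small, forbids independent sets
  of size \<open>k\<close>, where \<open>p k\<close> is a large multiple of \<open>ln n\<close>, and bounds by \<open>O(ln n)\<close> the average degree of
  every set of at most \<open>2 k\<close> vertices. Both classes of an induced bipartite subgraph are independent,
  hence such a subgraph has fewer than \<open>2 k\<close> vertices.
\<close>

section \<open>Random independent sets with uniform marginals\<close>

text \<open>Where the logarithm comes from: there are at most n^k sets of size k, and one of them is
  independent with probability about exp(-Omega(p k^2)), so p k of order ln n suffices. At this size
  the typical number of edges inside a set is again O(k ln n), which is the average-degree bound.

  Both union bounds need exponential moments with a constant exponent. For sets of at most
  \<open>2 * k\<close> vertices these follow because the second-order error is governed by
  codegrees. The degree of a new vertex, however, is the size of \<open>I\<close> within the whole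
  vertex set, where only the square of the degree bound is used; there the exponent is
  \<open>a = n powr (-1/5)\<close>, small enough for the error and still leaving a p n a power of n.

  The compensating deaths cost a survival factor \<sigma> = exp(-4 p Y). Since Y is of order p n,
  the product p Y is of order \<epsilon> ln n and every loss is n^O(\<epsilon>). Hence \<epsilon> is
  taken as a small fixed multiple of \<beta>, which affects only c and C.

  Each requirement on the current graph is coded as an exponential sum, so the bound 4 on a single
  number carries all hypotheses of the next attachment.\<close>

lemma exp_le_quadratic:
  fixes y c K :: real
  assumes "y \<le> c" "exp c \<le> K" "1 \<le> K"
  shows "exp y \<le> 1 + y + K * y\<^sup>2"
proof -
  obtain t where t: "\<bar>t\<bar> \<le> \<bar>y\<bar>" "exp y = 1 + y + exp t / 2 * y\<^sup>2"
    using Maclaurin_exp_le[of y 2] by (auto simp: numeral_2_eq_2)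
  show ?thesis
  \<comment> \<open>For \<open>y > 0\<close> the remainder point lies below \<open>c\<close>. For
    \<open>y \<le> 0\<close> there is no bound on the size of \<open>y\<close>, but coefficient 1
    already suffices.\<close>
  proof (cases "y \<le> 0")
    case False
    then have "t \<le> c" using t assms by auto
    then have "exp t \<le> K" using assms by (meson exp_le_cancel_iff order_trans)
    then have "exp t / 2 \<le> K" using assms(3) by linarith
    then show ?thesis unfolding t(2) by (intro add_left_mono mult_right_mono) auto
  next
    case True
    have "exp y \<le> 1 + y + y\<^sup>2"
    proof (cases "y \<le> -1")
      case True
      have "exp y \<le> 1" using True by simp
      moreover have "0 \<le> y * (1 + y)" using True by (simp add: mult_nonpos_nonpos)
      then have "0 \<le> y + y\<^sup>2" by (simp add: power2_eq_square algebra_simps)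
      ultimately show ?thesis by linarith
    next
      case False
      have "exp (-y) \<ge> 1 + (-y)" by (rule exp_ge_add_one_self)
      then have "exp y \<le> 1 / (1 - y)"
        using True by (simp add: exp_minus field_simps)
      also have "\<dots> \<le> 1 + y + y\<^sup>2"
      proof -
        have "(1 + y + y\<^sup>2) * (1 - y) = 1 - y ^ 3"
          by (simp add: algebra_simps power2_eq_square power3_eq_cube)
        moreover have "y ^ 3 \<le> 0" using True by (simp add: power3_eq_cube mult_nonneg_nonpos mult_nonpos_nonpos)
        ultimately have "1 \<le> (1 + y + y\<^sup>2) * (1 - y)" by linarith
        then show ?thesis using True by (subst pos_divide_le_eq) auto
      qed
      finally show ?thesis .
    qed
    also have "\<dots> \<le> 1 + y + K * y\<^sup>2"
      using assms(3) mult_right_mono[of 1 K "y\<^sup>2"] by simp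
    finally show ?thesis .
  qed
qed

section \<open>The compensated greedy process and its one-step operator\<close>

locale neighbourhood_process =
  fixes V :: "'a set" and N :: "'a \<Rightarrow> 'a set" and p Y :: real and J :: nat
  assumes finite_V: "finite V"
    and N_subset: "w \<in> V \<Longrightarrow> N w \<subseteq> V"
    and N_sym: "x \<in> N w \<Longrightarrow> w \<in> N x"
    and N_irrefl: "w \<notin> N w"
    and p_pos: "0 < p" and Y_pos: "0 < Y" and J_pos: "0 < J"
    and hazard_half: "2 * p * Y / J \<le> 1 / 2"
    and hazard_total: "card V * (2 * p * Y / J) \<le> 1"
    and survival_Y: "1 \<le> Y * (1 - 2 * p * Y / J) ^ J"
begin

text \<open>\<open>h\<close> is the probability that a vertex leaves \<open>U\<close> in one step
  and \<open>s j\<close> the probability of surviving \<open>j\<close> steps. The pick rate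
  \<open>q j\<close> is chosen so that \<open>q j * s j = p / J\<close>: apart from discarded runs,
  the \<open>J\<close> steps together pick each vertex with probability \<open>p\<close>.\<close>

definition h :: real where "h = 2 * p * Y / J"
definition s :: "nat \<Rightarrow> real" where "s j = (1 - h) ^ j"
definition q :: "nat \<Rightarrow> real" where "q j = p / (J * s j)"

text \<open>The cap on degrees into \<open>U\<close> shrinks at the rate at which \<open>U\<close>
  itself is expected to shrink.\<close>

definition good :: "nat \<Rightarrow> 'a set \<Rightarrow> bool" where
  "good j U \<longleftrightarrow> (\<forall>w\<in>V. card (N w \<inter> U) \<le> Y * s j)"

text \<open>
  Whatever the degrees inside \<open>U\<close> are, every vertex leaves \<open>U\<close> with probability exactly \<open>h\<close>:
  the spontaneous deaths compensate for the uneven numbers of neighbours.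
\<close>
definition step :: "nat \<Rightarrow> 'a set \<Rightarrow> 'a set \<Rightarrow> ('a set \<Rightarrow> 'a set \<Rightarrow> real) \<Rightarrow> real" where
  "step j U I f =
     (\<Sum>z\<in>U. q j * f (U - {z} - N z) (insert z I))
   + (\<Sum>w\<in>U. (h - q j * (1 + card (N w \<inter> U))) * f (U - {w}) I)
   + (1 - (\<Sum>w\<in>U. h - q j * card (N w \<inter> U))) * f U I"

lemma h_pos: "0 < h" and h_half: "h \<le> 1 / 2" and h_total: "card V * h \<le> 1"
  using p_pos Y_pos J_pos hazard_half hazard_total by (auto simp: h_def)

lemma s_pos: "0 < s j" and s_le_1: "s j \<le> 1" and s_Suc: "s (Suc j) = s j * (1 - h)"
  using h_pos h_half by (auto simp: s_def power_le_one)

lemma s_antimono: "i \<le> j \<Longrightarrow> s j \<le> s i"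
  using h_pos h_half by (simp add: s_def power_decreasing)

lemma s_lower: "j \<le> J \<Longrightarrow> 1 \<le> Y * s j"
  using s_antimono[of j J] survival_Y Y_pos unfolding s_def h_def
  by (smt (verit) mult_left_mono)

lemma q_pos: "0 < q j"
  using p_pos s_pos J_pos by (simp add: q_def)

lemma q_s: "q j * s j = p / J"
  using s_pos[of j] by (simp add: q_def)

text \<open>Since \<open>1 \<le> Y * s j\<close>, the vertex itself counts for no more than its
  neighbours; this is the origin of the factor 2 in \<open>h\<close>. It guarantees that in good
  states the compensating death probabilities are non-negative.\<close>

lemma q_bound: "j \<le> J \<Longrightarrow> q j * (1 + Y * s j) \<le> h"
proof -
  assume "j \<le> J"
  then have "q j * (1 + Y * s j) \<le> q j * (2 * (Y * s j))"
    using s_lower[of j] q_pos[of j] by (intro mult_left_mono) auto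
  also have "\<dots> = 2 * Y * (q j * s j)" by simp
  also have "\<dots> = h" unfolding q_s h_def by simp
  finally show ?thesis .
qed

lemma death_nonneg:
  assumes "good j U" "j \<le> J" "w \<in> V"
  shows "0 \<le> h - q j * (1 + card (N w \<inter> U))"
proof -
  have "q j * (1 + card (N w \<inter> U)) \<le> q j * (1 + Y * s j)"
    using assms q_pos[of j] by (intro mult_left_mono) (auto simp: good_def)
  then show ?thesis using q_bound[OF assms(2)] by linarith
qed

lemma q_le_h:
  assumes "j \<le> J" shows "q j \<le> h"
proof -
  have "q j * 1 \<le> q j * (1 + Y * s j)"
    using q_pos[of j] Y_pos s_pos[of j] by (intro mult_left_mono) auto
  then show ?thesis using q_bound[OF assms] by linarith
qed

text \<open>In the total probability of picks and deaths, the pick of \<open>w\<close> cancels the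
  \<open>1\<close> in the death probability of \<open>w\<close>; only
  \<open>h - q j * card (N w \<inter> U)\<close> remains per vertex, and
  \<open>card V * h \<le> 1\<close> covers the sum.\<close>

lemma null_nonneg:
  assumes "U \<subseteq> V"
  shows "0 \<le> 1 - (\<Sum>w\<in>U. h - q j * card (N w \<inter> U))"
proof -
  have "(\<Sum>w\<in>U. h - q j * card (N w \<inter> U)) \<le> (\<Sum>w\<in>U. h)"
    using q_pos[of j] by (intro sum_mono) simp
  also have "\<dots> \<le> card V * h"
    using card_mono[OF finite_V assms] h_pos by simp
  finally show ?thesis using h_total by linarith
qed

lemma step_mono:
  assumes "good j U" "j \<le> J" "U \<subseteq> V"
    and "\<And>z. z \<in> U \<Longrightarrow> f (U - {z} - N z) (insert z I) \<le> g (U - {z} - N z) (insert z I)"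
    and "\<And>w. w \<in> U \<Longrightarrow> f (U - {w}) I \<le> g (U - {w}) I"
    and "f U I \<le> g U I"
  shows "step j U I f \<le> step j U I g"
  unfolding step_def
  using assms q_pos[of j] death_nonneg[OF assms(1,2)] null_nonneg[OF assms(3), of j]
  by (intro add_mono sum_mono mult_left_mono) (auto simp: less_imp_le)

lemma step_add: "step j U I (\<lambda>U I. f U I + g U I) = step j U I f + step j U I g"
  unfolding step_def distrib_left sum.distrib by simp

lemma step_cmult: "step j U I (\<lambda>U I. c * f U I) = c * step j U I f"
  unfolding step_def by (simp add: sum_distrib_left algebra_simps)

lemma step_sum: "step j U I (\<lambda>U I. \<Sum>x\<in>A. f x U I) = (\<Sum>x\<in>A. step j U I (f x))"
proof (induction A rule: infinite_finite_induct)
  case (insert x A)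
  then show ?case by (simp add: step_add)
qed (simp_all add: step_def)

lemma step_const: "step j U I (\<lambda>U I. c) = c"
  unfolding step_def
  by (simp add: sum_distrib_right[symmetric] sum.distrib sum_subtractf algebra_simps
      sum_distrib_left[symmetric] del: of_nat_sum)

lemma sum_card_neighbours:
  assumes "A \<subseteq> V" "B \<subseteq> V"
  shows "(\<Sum>z\<in>A. card (N z \<inter> B)) = (\<Sum>x\<in>B. card (N x \<inter> A))"
proof -
  have fin: "finite A" "finite B" using assms finite_V finite_subset by auto
  have "(\<Sum>z\<in>A. card (N z \<inter> B)) = (\<Sum>z\<in>A. \<Sum>x\<in>B. if x \<in> N z then 1 else 0)"
    using fin by (simp add: sum.If_cases Int_def conj_commute)
  also have "\<dots> = (\<Sum>x\<in>B. \<Sum>z\<in>A. if x \<in> N z then 1 else 0)"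
    by (rule sum.swap)
  also have "\<dots> = (\<Sum>x\<in>B. \<Sum>z\<in>A. if z \<in> N x then 1 else 0)"
    by (intro sum.cong refl) (auto dest: N_sym)
  also have "\<dots> = (\<Sum>x\<in>B. card (N x \<inter> A))"
    using fin by (simp add: sum.If_cases Int_def conj_commute)
  finally show ?thesis .
qed

text \<open>The first-order terms are exact: picks in \<open>S\<close> contribute
  \<open>q j * (exp a - 1)\<close> and departures \<open>- b * h\<close> per vertex of
  \<open>U \<inter> S\<close>, whatever the degrees are. Only the second-order term depends on the
  graph, through \<open>Q\<close>. \<open>K\<close> bounds \<open>exp (- b * x)\<close> over the
  possible numbers \<open>x\<close> of vertices lost in one step.\<close>

lemma step_exp:
  fixes a b K Q :: real
  assumes good: "good j U" and j: "j \<le> J" and U: "U \<subseteq> V" and I: "finite I" "I \<inter> U = {}"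
    and ab: "0 \<le> a * b" and K: "1 \<le> K" "exp (- b * (1 + Y * s j)) \<le> K"
    and Q: "(\<Sum>z\<in>U. (card (N z \<inter> (U \<inter> S)))\<^sup>2) \<le> Q * card (U \<inter> S)"
  shows "step j U I (\<lambda>U I. exp (a * card (I \<inter> S) + b * card (U \<inter> S))) \<le>
    exp (a * card (I \<inter> S) + b * card (U \<inter> S)
         + (q j * (exp a - 1) - b * h + 2 * K * b\<^sup>2 * (q j * Q + h)) * card (U \<inter> S))"
proof -
  define T where "T = U \<inter> S"
  define E where "E = exp (a * card (I \<inter> S) + b * card T)"
  define ind where "ind z = (if z \<in> S then 1 else 0 :: real)" for z
  define \<delta> where "\<delta> z = ind z + real (card (N z \<inter> T))" for z
  define k where "k w = h - q j * (1 + card (N w \<inter> U))" for w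
  have finU: "finite U" using U finite_V finite_subset by blast
  have finT: "finite T" and TV: "T \<subseteq> V" using finU U by (auto simp: T_def)
  have kpos: "0 \<le> k w" if "w \<in> U" for w
    using death_nonneg[OF good j, of w] that U by (auto simp: k_def)
  have ind: "0 \<le> ind z" "ind z \<le> 1" "(ind z)\<^sup>2 = ind z" for z by (auto simp: ind_def)
  have sum_ind: "(\<Sum>z\<in>U. f z * ind z) = (\<Sum>z\<in>T. f z)" for f :: "'a \<Rightarrow> real"
    using finU by (simp add: ind_def T_def sum.inter_restrict if_distrib cong: if_cong)
  have card_pick: "real (card ((U - {z} - N z) \<inter> S)) = card T - \<delta> z" if "z \<in> U" for z
  proof -
    have "T = ((U - {z} - N z) \<inter> S) \<union> (N z \<inter> T) \<union> ({z} \<inter> S)" using that by (auto simp: T_def)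
    also have "card \<dots> = card ((U - {z} - N z) \<inter> S) + card (N z \<inter> T) + card ({z} \<inter> S)"
      using finU finT N_irrefl[of z] by (subst card_Un_disjoint; (subst card_Un_disjoint)?; auto)
    finally show ?thesis by (auto simp: \<delta>_def ind_def)
  qed
  have card_kill: "real (card ((U - {w}) \<inter> S)) = card T - ind w" if "w \<in> U" for w
  proof -
    have "T = ((U - {w}) \<inter> S) \<union> ({w} \<inter> S)" using that by (auto simp: T_def)
    also have "card \<dots> = card ((U - {w}) \<inter> S) + card ({w} \<inter> S)"
      using finU by (subst card_Un_disjoint) auto
    finally show ?thesis by (auto simp: ind_def)
  qed
  have card_ins: "real (card (insert z I \<inter> S)) = card (I \<inter> S) + ind z" if "z \<in> U" for z
  proof -
    have "z \<notin> I" using I that by auto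
    then show ?thesis using I by (auto simp: ind_def Int_insert_left)
  qed
  have pick: "exp (a * card (insert z I \<inter> S) + b * card ((U - {z} - N z) \<inter> S))
      = E * exp (a * ind z - b * \<delta> z)" if "z \<in> U" for z
    unfolding card_pick[OF that] card_ins[OF that] E_def exp_add[symmetric]
    by (simp add: algebra_simps)
  have kill: "exp (a * card (I \<inter> S) + b * card ((U - {w}) \<inter> S)) = E * exp (- b * ind w)"
    if "w \<in> U" for w
    unfolding card_kill[OF that] E_def exp_add[symmetric] by (simp add: algebra_simps)
  have \<delta>_le: "\<delta> z \<le> 1 + Y * s j" if "z \<in> U" for z
  proof -
    have "card (N z \<inter> T) \<le> card (N z \<inter> U)" using finU by (intro card_mono) (auto simp: T_def)
    moreover have "card (N z \<inter> U) \<le> Y * s j" using good that U by (auto simp: good_def)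
    ultimately show ?thesis using ind[of z] by (simp add: \<delta>_def)
  qed
  have \<delta>_nonneg: "0 \<le> \<delta> z" for z using ind[of z] by (simp add: \<delta>_def)
  have quad: "exp (- b * x) - 1 \<le> - b * x + K * b\<^sup>2 * x\<^sup>2" if "0 \<le> x" "x \<le> 1 + Y * s j" for x
  proof -
    have "- b * x \<le> max 0 (- b * (1 + Y * s j))"
    proof (cases "0 \<le> b")
      case True
      then have "- b * x \<le> 0" using that by simp
      then show ?thesis by simp
    next
      case False
      then have "- b * x \<le> - b * (1 + Y * s j)" using that by (intro mult_left_mono) auto
      then show ?thesis by simp
    qed
    moreover have "exp (max 0 (- b * (1 + Y * s j))) \<le> K" using K by (auto simp: max_def)
    ultimately have "exp (- b * x) \<le> 1 + (- b * x) + K * (- b * x)\<^sup>2"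
      using exp_le_quadratic K(1) by blast
    then show ?thesis by (simp add: power_mult_distrib)
  qed
  have pick_le: "exp (a * ind z - b * \<delta> z) - 1 \<le>
      (exp a - 1) * ind z + (- b * \<delta> z + K * b\<^sup>2 * (\<delta> z)\<^sup>2)" if "z \<in> U" for z
  proof -
    have "(exp (a * ind z) - 1) * (exp (- b * \<delta> z) - 1) \<le> 0"
    proof (cases "0 \<le> a \<and> 0 \<le> b")
      case True
      then show ?thesis using ind[of z] \<delta>_nonneg[of z] by (intro mult_nonneg_nonpos) auto
    next
      case False
      then consider "a \<le> 0" "b \<le> 0" | "a = 0" | "b = 0"
        using ab unfolding zero_le_mult_iff by linarith
      then show ?thesis
      proof cases
        case 1
        have "a * ind z \<le> 0" using 1(1) ind(1)[of z] by (rule mult_nonpos_nonneg)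
        moreover have "b * \<delta> z \<le> 0" using 1(2) \<delta>_nonneg[of z] by (rule mult_nonpos_nonneg)
        ultimately show ?thesis by (intro mult_nonpos_nonneg) simp_all
      qed simp_all
    qed
    then have "exp (a * ind z) * exp (- b * \<delta> z) - 1 \<le> (exp (a * ind z) - 1) + (exp (- b * \<delta> z) - 1)"
      by (simp add: algebra_simps)
    moreover have "exp (a * ind z) - 1 = (exp a - 1) * ind z" by (simp add: ind_def)
    moreover have "exp (a * ind z - b * \<delta> z) = exp (a * ind z) * exp (- b * \<delta> z)"
      by (simp add: exp_add[symmetric])
    ultimately show ?thesis using quad[OF \<delta>_nonneg \<delta>_le[OF that]] by linarith
  qed
  have kill_le: "exp (- b * ind w) - 1 \<le> - b * ind w + K * b\<^sup>2 * ind w" for w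
  proof -
    have "0 \<le> Y * s j" using Y_pos s_pos[of j] by simp
    then show ?thesis using quad[of "ind w"] ind[of w] by simp
  qed
  \<comment> \<open>The exact drift: double counting edges between \<open>U\<close> and
    \<open>T\<close> turns removals by neighbours into degrees, which the death probabilities
    \<open>k\<close> cancel.\<close>
  have mean: "(\<Sum>z\<in>U. q j * \<delta> z) + (\<Sum>w\<in>U. k w * ind w) = h * card T"
  proof -
    have "(\<Sum>z\<in>U. real (card (N z \<inter> T))) = (\<Sum>x\<in>T. real (card (N x \<inter> U)))"
      unfolding of_nat_sum[symmetric] sum_card_neighbours[OF U TV] ..
    then have "(\<Sum>z\<in>U. \<delta> z) = card T + (\<Sum>x\<in>T. real (card (N x \<inter> U)))"
      using sum_ind[of "\<lambda>_. 1"] by (simp add: \<delta>_def sum.distrib)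
    moreover have "(\<Sum>w\<in>U. k w * ind w) = h * card T - q j * (card T + (\<Sum>x\<in>T. real (card (N x \<inter> U))))"
      unfolding sum_ind k_def by (simp add: sum_subtractf sum.distrib sum_distrib_left[symmetric])
    ultimately show ?thesis by (simp add: sum_distrib_left[symmetric])
  qed
  \<comment> \<open>The square of a sum is at most twice the sum of the squares. Apart from
    \<open>Q\<close> this leaves \<open>2 * q j + (h - q j)\<close>, and \<open>q j \<le> h\<close>
    bounds it by \<open>2 * h\<close>.\<close>
  have second: "(\<Sum>z\<in>U. q j * (\<delta> z)\<^sup>2) + (\<Sum>w\<in>U. k w * ind w) \<le> 2 * (q j * Q + h) * card T"
  proof -
    have "(\<Sum>z\<in>U. q j * (\<delta> z)\<^sup>2) \<le> (\<Sum>z\<in>U. q j * (2 * ind z + 2 * (real (card (N z \<inter> T)))\<^sup>2))"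
    proof (intro sum_mono mult_left_mono)
      fix z
      have "0 \<le> (ind z - real (card (N z \<inter> T)))\<^sup>2" by simp
      then show "(\<delta> z)\<^sup>2 \<le> 2 * ind z + 2 * (real (card (N z \<inter> T)))\<^sup>2"
        using ind(3)[of z] by (simp add: \<delta>_def power2_sum power2_diff)
    qed (use q_pos[of j] in simp)
    also have "\<dots> = q j * (2 * (\<Sum>z\<in>U. ind z) + 2 * (\<Sum>z\<in>U. (real (card (N z \<inter> T)))\<^sup>2))"
      by (simp only: sum_distrib_left[symmetric] sum.distrib)
    also have "(\<Sum>z\<in>U. ind z) = card T"
      using sum_ind[of "\<lambda>_. 1"] by simp
    also have "q j * (2 * real (card T) + 2 * (\<Sum>z\<in>U. (real (card (N z \<inter> T)))\<^sup>2))
        \<le> q j * (2 * real (card T) + 2 * (Q * card T))"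
      using Q q_pos[of j] unfolding T_def by (intro mult_left_mono add_left_mono) auto
    finally have "(\<Sum>z\<in>U. q j * (\<delta> z)\<^sup>2) \<le> 2 * q j * card T + 2 * q j * Q * card T"
      by (simp add: algebra_simps)
    moreover have "(\<Sum>w\<in>U. k w * ind w) \<le> (h - q j) * card T"
    proof -
      have "(\<Sum>w\<in>U. k w * ind w) \<le> (\<Sum>w\<in>U. (h - q j) * ind w)"
        using q_pos[of j] ind by (intro sum_mono mult_right_mono) (auto simp: k_def algebra_simps)
      then show ?thesis using sum_ind[of "\<lambda>_. h - q j"] by (simp add: mult.commute)
    qed
    moreover have "q j * card T \<le> h * card T" using q_le_h[OF j] by (intro mult_right_mono) auto
    ultimately show ?thesis by (simp add: algebra_simps)
  qed
  have null: "(\<Sum>w\<in>U. h - q j * card (N w \<inter> U)) = (\<Sum>z\<in>U. q j) + (\<Sum>w\<in>U. k w)"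
    by (simp add: k_def distrib_left sum.distrib sum_subtractf)
  have "step j U I (\<lambda>U I. exp (a * card (I \<inter> S) + b * card (U \<inter> S))) =
     (\<Sum>z\<in>U. q j * (E * exp (a * ind z - b * \<delta> z))) + (\<Sum>w\<in>U. k w * (E * exp (- b * ind w)))
     + (1 - ((\<Sum>z\<in>U. q j) + (\<Sum>w\<in>U. k w))) * E"
    unfolding step_def null k_def[symmetric]
    using pick kill by (simp add: E_def T_def cong: sum.cong)
  also have "\<dots> = E * (1 + (\<Sum>z\<in>U. q j * (exp (a * ind z - b * \<delta> z) - 1))
      + (\<Sum>w\<in>U. k w * (exp (- b * ind w) - 1)))"
    by (simp add: algebra_simps sum_subtractf sum_distrib_left)
  also have "\<dots> \<le> E * (1 + (\<Sum>z\<in>U. q j * ((exp a - 1) * ind z + (- b * \<delta> z + K * b\<^sup>2 * (\<delta> z)\<^sup>2)))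
      + (\<Sum>w\<in>U. k w * (- b * ind w + K * b\<^sup>2 * ind w)))"
    using pick_le kill_le kpos q_pos[of j]
    by (intro mult_left_mono add_mono sum_mono order_refl) (auto simp: E_def)
  also have "\<dots> = E * (1 + q j * (exp a - 1) * card T
      - b * ((\<Sum>z\<in>U. q j * \<delta> z) + (\<Sum>w\<in>U. k w * ind w))
      + K * b\<^sup>2 * ((\<Sum>z\<in>U. q j * (\<delta> z)\<^sup>2) + (\<Sum>w\<in>U. k w * ind w)))"
  proof -
    have "(\<Sum>z\<in>U. q j * ((exp a - 1) * ind z)) = q j * (exp a - 1) * card T"
      using sum_ind[of "\<lambda>_. q j * (exp a - 1)"] by (simp add: mult_ac)
    moreover have "(\<Sum>z\<in>U. q j * (- b * \<delta> z)) = - b * (\<Sum>z\<in>U. q j * \<delta> z)"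
      "(\<Sum>w\<in>U. k w * (- b * ind w)) = - b * (\<Sum>w\<in>U. k w * ind w)"
      "(\<Sum>z\<in>U. q j * (K * b\<^sup>2 * (\<delta> z)\<^sup>2)) = K * b\<^sup>2 * (\<Sum>z\<in>U. q j * (\<delta> z)\<^sup>2)"
      "(\<Sum>w\<in>U. k w * (K * b\<^sup>2 * ind w)) = K * b\<^sup>2 * (\<Sum>w\<in>U. k w * ind w)"
      by (simp_all add: sum_distrib_left mult_ac)
    ultimately have "(\<Sum>z\<in>U. q j * ((exp a - 1) * ind z + (- b * \<delta> z + K * b\<^sup>2 * (\<delta> z)\<^sup>2)))
        + (\<Sum>w\<in>U. k w * (- b * ind w + K * b\<^sup>2 * ind w))
      = q j * (exp a - 1) * card T - b * ((\<Sum>z\<in>U. q j * \<delta> z) + (\<Sum>w\<in>U. k w * ind w))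
        + K * b\<^sup>2 * ((\<Sum>z\<in>U. q j * (\<delta> z)\<^sup>2) + (\<Sum>w\<in>U. k w * ind w))"
      unfolding distrib_left sum.distrib by simp
    then show ?thesis by (simp only: add.assoc) (simp add: algebra_simps)
  qed
  also have "\<dots> \<le> E * (1 + q j * (exp a - 1) * card T - b * (h * card T)
      + K * b\<^sup>2 * (2 * (q j * Q + h) * card T))"
    using second K(1) unfolding mean by (intro mult_left_mono add_left_mono) (auto simp: E_def)
  also have "\<dots> = E * (1 + (q j * (exp a - 1) - b * h + 2 * K * b\<^sup>2 * (q j * Q + h)) * card T)"
    by (simp add: algebra_simps)
  also have "\<dots> \<le> E * exp ((q j * (exp a - 1) - b * h + 2 * K * b\<^sup>2 * (q j * Q + h)) * card T)"
    by (intro mult_left_mono exp_ge_add_one_self) (simp add: E_def)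
  finally show ?thesis unfolding E_def T_def exp_add .
qed


section \<open>Expectations over whole runs\<close>

text \<open>Runs that meet a bad state are discarded, so the total mass may be less than 1.\<close>

primrec ev :: "nat \<Rightarrow> 'a set \<Rightarrow> 'a set \<Rightarrow> ('a set \<Rightarrow> real) \<Rightarrow> real" where
  "ev 0 U I f = f I"
| "ev (Suc m) U I f =
     (if good (J - Suc m) U then step (J - Suc m) U I (\<lambda>U I. ev m U I f) else 0)"

definition state :: "'a set \<Rightarrow> 'a set \<Rightarrow> bool" where
  "state U I \<longleftrightarrow> U \<subseteq> V \<and> I \<subseteq> V \<and> I \<inter> U = {} \<and> (\<forall>z\<in>I. N z \<inter> U = {}) \<and> (\<forall>z\<in>I. N z \<inter> I = {})"

lemma state_pick: "state U I \<Longrightarrow> z \<in> U \<Longrightarrow> state (U - {z} - N z) (insert z I)"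
  using N_irrefl[of z] N_sym[of _ z] N_sym[of z] unfolding state_def by blast

lemma state_kill: "state U I \<Longrightarrow> state (U - {w}) I"
  unfolding state_def by blast

lemma state_init: "state V {}"
  unfolding state_def by simp

lemma step_mono_state:
  assumes "good j U" "j \<le> J" "state U I" "\<And>U I. state U I \<Longrightarrow> f U I \<le> g U I"
  shows "step j U I f \<le> step j U I g"
  using assms state_pick state_kill by (intro step_mono) (auto simp: state_def[of U I])

text \<open>The supermartingale principle, with \<open>m\<close> counting the steps still to come.
  Non-negativity of \<open>G\<close> takes care of discarded runs, whose contribution is 0.\<close>

lemma ev_le:
  assumes super: "\<And>m U I. m < J \<Longrightarrow> state U I \<Longrightarrow> good (J - Suc m) U \<Longrightarrow>
      step (J - Suc m) U I (G m) \<le> G (Suc m) U I"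
    and nonneg: "\<And>m U I. state U I \<Longrightarrow> 0 \<le> G m U I"
    and final: "\<And>U I. state U I \<Longrightarrow> f I \<le> G 0 U I"
    and "m \<le> J" "state U I"
  shows "ev m U I f \<le> G m U I"
  using assms(4,5)
proof (induction m arbitrary: U I)
  case 0
  then show ?case using final by simp
next
  case (Suc m)
  show ?case
  proof (cases "good (J - Suc m) U")
    case True
    have "step (J - Suc m) U I (\<lambda>U I. ev m U I f) \<le> step (J - Suc m) U I (G m)"
      using Suc by (intro step_mono_state True) auto
    also have "\<dots> \<le> G (Suc m) U I" using super Suc.prems True by simp
    finally show ?thesis using True by simp
  next
    case False
    then show ?thesis using nonneg[OF Suc.prems(2), of "Suc m"] by simp
  qed
qed

lemma ev_mono:
  assumes "\<And>U I. state U I \<Longrightarrow> f I \<le> g I" "m \<le> J" "state U I"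
  shows "ev m U I f \<le> ev m U I g"
  using assms(2,3)
proof (induction m arbitrary: U I)
  case (Suc m)
  then show ?case by (auto intro!: step_mono_state)
qed (use assms in auto)

lemma ev_zero: "ev m U I (\<lambda>I. 0) = 0"
  by (induction m arbitrary: U I) (simp_all add: step_const)

lemma ev_add: "ev m U I (\<lambda>I. f I + g I) = ev m U I f + ev m U I g"
  by (induction m arbitrary: U I) (simp_all add: step_add)

lemma ev_cmult: "ev m U I (\<lambda>I. c * f I) = c * ev m U I f"
  by (induction m arbitrary: U I) (simp_all add: step_cmult)

lemma ev_sum: "ev m U I (\<lambda>I. \<Sum>x\<in>A. f x I) = (\<Sum>x\<in>A. ev m U I (f x))"
proof (induction A rule: infinite_finite_induct)
  case (insert x A)
  then show ?case by (simp add: ev_add)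
qed (simp_all add: ev_zero)

section \<open>The law of the final independent set\<close>

definition mass :: "'a set \<Rightarrow> real" where
  "mass I = ev J V {} (\<lambda>I'. if I' = I then 1 else 0)"

lemma mass_nonneg: "0 \<le> mass I"
  using ev_mono[of "\<lambda>_. 0" "\<lambda>I'. if I' = I then 1 else 0" J V "{}"] state_init
  by (simp add: mass_def ev_zero)

lemma mass_support:
  assumes "mass I \<noteq> 0" shows "I \<subseteq> V" "\<forall>z\<in>I. N z \<inter> I = {}"
proof -
  have "\<exists>U. state U I"
  proof (rule ccontr)
    assume "\<nexists>U. state U I"
    then have "mass I \<le> ev J V {} (\<lambda>_. 0)"
      unfolding mass_def using state_init by (intro ev_mono) auto
    then show False using assms mass_nonneg[of I] by (simp add: ev_zero)
  qed
  then show "I \<subseteq> V" "\<forall>z\<in>I. N z \<inter> I = {}" by (auto simp: state_def)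
qed

text \<open>By linearity \<open>f\<close> may be expanded into indicators of the subsets of
  \<open>V\<close>, the only possible outcomes. From here on a finite measure can stand in for the
  process.\<close>

lemma sum_mass: "(\<Sum>I\<in>Pow V. mass I * f I) = ev J V {} f"
proof -
  have "(\<Sum>I\<in>Pow V. mass I * f I) = ev J V {} (\<lambda>I'. \<Sum>I\<in>Pow V. f I * (if I' = I then 1 else 0))"
    unfolding ev_sum ev_cmult mass_def by (simp add: mult.commute)
  also have "\<dots> = ev J V {} f"
    using finite_V state_init
    by (intro order_antisym ev_mono) (auto simp: state_def if_distrib cong: if_cong)
  finally show ?thesis .
qed

lemma mass_total_le: "(\<Sum>I\<in>Pow V. mass I) \<le> 1"
proof -
  have "ev J V {} (\<lambda>_. 1) \<le> 1"
    using state_init by (intro ev_le[where G = "\<lambda>_ _ _. 1"]) (auto simp: step_const)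
  then show ?thesis using sum_mass[of "\<lambda>_. 1"] by simp
qed

section \<open>Exponential moments, lost mass and inclusion probabilities\<close>

lemma ratio_s: "l / s (Suc j) - l / s (Suc j) * h = l / s j"
proof -
  have "l / s (Suc j) - l / s (Suc j) * h = l / s (Suc j) * (1 - h)" by (simp only: right_diff_distrib mult_1_right)
  then show ?thesis using h_half by (simp add: s_Suc)
qed

text \<open>One factor \<open>1 / s j\<close> is kept because the weights carry it; the remaining
  ones are bounded through \<sigma>, uniformly in time. Since \<open>s (Suc j)\<close> is at least
  half of \<open>s j\<close>, the leading 2 becomes 8.\<close>

lemma second_order:
  fixes l L K \<sigma> Q :: real
  assumes "j < J" "\<bar>l\<bar> \<le> L" "0 < \<sigma>" "\<sigma> \<le> s J" "0 \<le> Q" "0 \<le> K"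
  shows "2 * K * (l / s (Suc j))\<^sup>2 * (q j * Q + h) \<le> 8 * K * L\<^sup>2 * p * (Q / \<sigma>\<^sup>2 + 2 * Y / \<sigma>) / J / s j"
proof -
  have sj: "0 < s j" "\<sigma> \<le> s j" using s_pos assms(1,4) s_antimono[of j J] by (auto intro: order_trans)
  have "s j / 2 \<le> s (Suc j)"
    unfolding s_Suc using h_half sj by (simp add: field_simps)
  then have "(s j / 2)\<^sup>2 \<le> (s (Suc j))\<^sup>2" using sj by (intro power_mono) auto
  moreover have "l\<^sup>2 \<le> L\<^sup>2" using assms(2) by (metis abs_le_square_iff abs_ge_zero abs_of_nonneg order_trans)
  ultimately have "(l / s (Suc j))\<^sup>2 \<le> L\<^sup>2 / (s j / 2)\<^sup>2"
    unfolding power_divide using sj by (intro frac_le) auto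
  also have "\<dots> = 4 * L\<^sup>2 / (s j)\<^sup>2" by (simp add: power_divide)
  finally have "2 * K * (l / s (Suc j))\<^sup>2 * (q j * Q + h) \<le> 2 * K * (4 * L\<^sup>2 / (s j)\<^sup>2) * (q j * Q + h)"
    using assms q_pos[of j] h_pos by (intro mult_right_mono mult_left_mono) auto
  also have "\<dots> = 8 * K * L\<^sup>2 * p * (Q / (s j)\<^sup>2 + 2 * Y / s j) / J / s j"
    using sj J_pos by (simp add: q_def h_def field_simps power2_eq_square)
  also have "\<dots> \<le> 8 * K * L\<^sup>2 * p * (Q / \<sigma>\<^sup>2 + 2 * Y / \<sigma>) / J / s j"
    using sj assms p_pos Y_pos
    by (intro divide_right_mono mult_left_mono add_mono frac_le power_mono) auto
  finally show ?thesis .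
qed

text \<open>A random set containing each vertex with probability \<open>p\<close> would give the
  rate \<open>p * (exp a - 1)\<close> to first order; \<open>L\<close> exceeds it by room for the
  accumulated second-order errors.\<close>

lemma ev_exp:
  fixes a L K \<sigma> Q :: real
  assumes S: "S \<subseteq> V" and sgn: "0 \<le> a * L" and K: "exp (4 * \<bar>L\<bar> * Y) \<le> K"
    and \<sigma>: "0 < \<sigma>" "\<sigma> \<le> s J" and Q: "0 \<le> Q"
    "\<And>j U. U \<subseteq> V \<Longrightarrow> good j U \<Longrightarrow> (\<Sum>z\<in>U. (card (N z \<inter> (U \<inter> S)))\<^sup>2) \<le> Q * card (U \<inter> S)"
    and L: "p * (exp a - 1) + 8 * K * L\<^sup>2 * p * (Q / \<sigma>\<^sup>2 + 2 * Y / \<sigma>) \<le> L"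
  shows "ev J V {} (\<lambda>I. exp (a * card (I \<inter> S))) \<le> exp (L * card S)"
proof -
  \<comment> \<open>A vertex in \<open>U\<close> at time \<open>J - m\<close> is still expected to
    be picked with probability \<open>p * m / J / s (J - m)\<close>, by survival from now on. The
    weight has this form with \<open>L\<close> for \<open>p\<close>; dividing by \<open>s\<close>
    cancels the drift exactly, by \<open>ratio_s\<close>.\<close>
  define G where "G m U I = exp (a * card (I \<inter> S) + L * m / J / s (J - m) * card (U \<inter> S))"
    for m and U I :: "'a set"
  have K1: "1 \<le> K" using K Y_pos by (smt (verit) abs_ge_zero one_le_exp_iff zero_le_mult_iff)
  have "ev J V {} (\<lambda>I. exp (a * card (I \<inter> S))) \<le> G J V {}"
  proof (rule ev_le)
    fix m U I assume m: "m < J" and st: "state U I" and good: "good (J - Suc m) U"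
    define j where "j = J - Suc m"
    define l where "l = L * m / J"
    define b where "b = l / s (Suc j)"
    have j: "j < J" "J - m = Suc j" "J - Suc m = j" using m by (auto simp: j_def)
    have sj: "0 < s j" "0 < s (Suc j)" by (rule s_pos)+
    have lL: "\<bar>l\<bar> \<le> \<bar>L\<bar>"
    proof -
      have "\<bar>L\<bar> * (m / J) \<le> \<bar>L\<bar> * 1" using m by (intro mult_left_mono) auto
      then show ?thesis by (simp add: l_def abs_mult)
    qed
    have "0 \<le> (a * L) * (m / J / s (Suc j))"
      by (rule mult_nonneg_nonneg[OF sgn]) (use sj in simp)
    then have ab: "0 \<le> a * b" by (simp add: b_def l_def mult.assoc)
    have "- b * (1 + Y * s j) \<le> 4 * \<bar>L\<bar> * Y"
    proof -
      \<comment> \<open>One factor 2 comes from \<open>1 \<le> Y * s j\<close>, the other from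
        \<open>h \<le> 1 / 2\<close>; together they are the 4 in the hypothesis on
        \<open>K\<close>.\<close>
      have "1 + Y * s j \<le> 4 * Y * s (Suc j)"
      proof -
        have "1 \<le> Y * s j" using s_lower[of j] j by simp
        moreover have "2 * (Y * s j) * h \<le> 2 * (Y * s j) * (1 / 2)"
          using h_half Y_pos sj by (intro mult_left_mono) auto
        ultimately show ?thesis unfolding s_Suc by (simp add: algebra_simps)
      qed
      then have "\<bar>b\<bar> * (1 + Y * s j) \<le> \<bar>b\<bar> * (4 * Y * s (Suc j))" by (intro mult_left_mono) auto
      also have "\<dots> = 4 * Y * \<bar>l\<bar>" using sj by (simp add: b_def abs_divide)
      also have "\<dots> \<le> 4 * Y * \<bar>L\<bar>" using lL Y_pos by simp
      finally have "\<bar>b\<bar> * (1 + Y * s j) \<le> 4 * \<bar>L\<bar> * Y" by (simp add: mult_ac)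
      moreover have "- b * (1 + Y * s j) \<le> \<bar>b\<bar> * (1 + Y * s j)"
        using Y_pos sj by (intro mult_right_mono) auto
      ultimately show ?thesis by linarith
    qed
    then have Kb: "exp (- b * (1 + Y * s j)) \<le> K" using K by (meson exp_le_cancel_iff order_trans)
    have UI: "U \<subseteq> V" "finite I" "I \<inter> U = {}" using st finite_V finite_subset by (auto simp: state_def)
    have "step j U I (G m) \<le> exp (a * card (I \<inter> S) + b * card (U \<inter> S)
         + (q j * (exp a - 1) - b * h + 2 * K * b\<^sup>2 * (q j * Q + h)) * card (U \<inter> S))"
      unfolding G_def j(2) b_def[symmetric] l_def[symmetric]
      using good j UI ab K1 Kb Q(2)[OF UI(1) good] by (intro step_exp) auto
    also have "\<dots> \<le> G (Suc m) U I"
    proof -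
      have "b + (q j * (exp a - 1) - b * h + 2 * K * b\<^sup>2 * (q j * Q + h)) \<le> (l + L / J) / s j"
      proof -
        have "2 * K * b\<^sup>2 * (q j * Q + h) \<le> 8 * K * \<bar>L\<bar>\<^sup>2 * p * (Q / \<sigma>\<^sup>2 + 2 * Y / \<sigma>) / J / s j"
          unfolding b_def using second_order[OF j(1) lL \<sigma> Q(1)] K1 by simp
        moreover have "q j * (exp a - 1) = p * (exp a - 1) / J / s j"
          using sj by (simp add: q_def)
        moreover have "b - b * h = l / s j"
          unfolding b_def by (rule ratio_s)
        moreover have "(p * (exp a - 1) + 8 * K * \<bar>L\<bar>\<^sup>2 * p * (Q / \<sigma>\<^sup>2 + 2 * Y / \<sigma>)) / J / s j \<le> L / J / s j"
          using L sj by (intro divide_right_mono) auto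
        ultimately show ?thesis by (simp add: add_divide_distrib)
      qed
      then have "(b + (q j * (exp a - 1) - b * h + 2 * K * b\<^sup>2 * (q j * Q + h))) * card (U \<inter> S)
          \<le> (l + L / J) / s j * card (U \<inter> S)"
        by (intro mult_right_mono) auto
      moreover have "l + L / J = L * Suc m / J"
        using J_pos by (simp add: l_def field_simps)
      ultimately show ?thesis unfolding G_def j(3) exp_le_cancel_iff by (simp add: algebra_simps)
    qed
    finally show "step (J - Suc m) U I (G m) \<le> G (Suc m) U I" unfolding j(3) .
  qed (auto simp: G_def state_init)
  also have "G J V {} = exp (L * card S)"
    using S J_pos by (simp add: G_def s_def Int_absorb1)
  finally show ?thesis .
qed

text \<open>A run is lost only when some vertex has too many neighbours in \<open>U\<close>.
  Rescaled by \<open>s\<close>, such a count has no drift, so an exponential supermartingale for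
  every \<open>w\<close> and a union bound suffice; the gap between the initial bound
  \<open>Y / 2\<close> and the cap \<open>Y\<close> gives the decay.\<close>

lemma mass_total_ge:
  fixes k \<sigma> Q :: real
  assumes k: "0 \<le> k" and \<sigma>: "0 < \<sigma>" "\<sigma> \<le> s J" and Q: "0 \<le> Q"
    "\<And>j U w. U \<subseteq> V \<Longrightarrow> good j U \<Longrightarrow> w \<in> V \<Longrightarrow>
      (\<Sum>z\<in>U. (card (N z \<inter> (U \<inter> N w)))\<^sup>2) \<le> Q * card (U \<inter> N w)"
    and small: "8 * k\<^sup>2 * p * (Q / \<sigma>\<^sup>2 + 2 * Y / \<sigma>) * Y \<le> 1"
    and deg: "\<And>w. w \<in> V \<Longrightarrow> card (N w) \<le> Y / 2"
  shows "1 - card V * exp (1 - k * Y / 2) \<le> (\<Sum>I\<in>Pow V. mass I)"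
proof -
  \<comment> \<open>The slack \<open>m / J\<close> releases \<open>1 / J\<close> per step to pay for
    the second-order error. Its initial value 1 is the 1 in the final exponent.\<close>
  define g where "g m U w = exp (k / s (J - m) * card (U \<inter> N w) - k * Y + m / J)"
    for m and U :: "'a set" and w
  define G where "G m U = (\<Sum>w\<in>V. g m U w)" for m U
  have super: "step (J - Suc m) U I (\<lambda>U I. G m U) \<le> G (Suc m) U"
    if m: "m < J" and st: "state U I" and good: "good (J - Suc m) U" for m U I
  proof -
    define j where "j = J - Suc m"
    define b where "b = k / s (Suc j)"
    have j: "j < J" "J - m = Suc j" "J - Suc m = j" using m by (auto simp: j_def)
    have sj: "0 < s j" "0 < s (Suc j)" by (rule s_pos)+
    have UI: "U \<subseteq> V" "finite I" "I \<inter> U = {}" using st finite_V finite_subset by (auto simp: state_def)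
    have b: "0 \<le> b" using k sj by (simp add: b_def)
    have "step j U I (\<lambda>U I. g m U w) \<le> g (Suc m) U w" if w: "w \<in> V" for w
    proof -
      \<comment> \<open>With exponent 0 on \<open>I\<close> only \<open>U\<close> is tracked, and
        \<open>b \<ge> 0\<close> allows \<open>K = 1\<close>.\<close>
      have "step j U I (\<lambda>U I. exp (0 * real (card (I \<inter> N w)) + b * card (U \<inter> N w)))
        \<le> exp (0 * real (card (I \<inter> N w)) + b * card (U \<inter> N w)
         + (q j * (exp 0 - 1) - b * h + 2 * 1 * b\<^sup>2 * (q j * Q + h)) * card (U \<inter> N w))"
        using good j UI b Y_pos sj Q(2)[OF UI(1) good w]
        by (intro step_exp) (auto simp: mult_nonneg_nonneg)
      also have "\<dots> \<le> exp (k / s j * card (U \<inter> N w) + 1 / J)"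
      proof -
        have t: "card (U \<inter> N w) \<le> Y * s j"
          using good w j by (auto simp: good_def Int_commute)
        have "2 * 1 * b\<^sup>2 * (q j * Q + h) \<le> 8 * 1 * k\<^sup>2 * p * (Q / \<sigma>\<^sup>2 + 2 * Y / \<sigma>) / J / s j"
          unfolding b_def using second_order[OF j(1) _ \<sigma> Q(1), of k k 1] k by simp
        then have "2 * 1 * b\<^sup>2 * (q j * Q + h) * card (U \<inter> N w)
            \<le> 8 * 1 * k\<^sup>2 * p * (Q / \<sigma>\<^sup>2 + 2 * Y / \<sigma>) / J / s j * card (U \<inter> N w)"
          by (intro mult_right_mono) auto
        also have "\<dots> \<le> 8 * 1 * k\<^sup>2 * p * (Q / \<sigma>\<^sup>2 + 2 * Y / \<sigma>) / J / s j * (Y * s j)"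
          using t sj p_pos Y_pos Q(1) \<sigma> by (intro mult_left_mono) auto
        also have "\<dots> = 8 * k\<^sup>2 * p * (Q / \<sigma>\<^sup>2 + 2 * Y / \<sigma>) * Y / J" using sj by simp
        also have "\<dots> \<le> 1 / J" using small by (intro divide_right_mono) auto
        finally have "2 * b\<^sup>2 * (q j * Q + h) * card (U \<inter> N w) \<le> 1 / J" by simp
        moreover have "b - b * h = k / s j"
          unfolding b_def by (rule ratio_s)
        then have "b * card (U \<inter> N w) - b * h * card (U \<inter> N w) = k / s j * card (U \<inter> N w)"
          by (metis left_diff_distrib)
        ultimately show ?thesis by (simp add: algebra_simps)
      qed
      finally have "step j U I (\<lambda>U I. exp (- k * Y + m / J) * exp (0 * real (card (I \<inter> N w)) + b * card (U \<inter> N w)))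
        \<le> exp (- k * Y + m / J) * exp (k / s j * card (U \<inter> N w) + 1 / J)"
        unfolding step_cmult by (intro mult_left_mono) auto
      then show ?thesis
        unfolding g_def j b_def exp_add[symmetric] by (simp add: algebra_simps add_divide_distrib)
    qed
    then show ?thesis unfolding G_def step_sum j(3) by (intro sum_mono)
  qed
  have G_nonneg: "0 \<le> G m U" for m U by (auto simp: G_def g_def intro: sum_nonneg)
  have "1 - G m U \<le> ev m U I (\<lambda>_. 1)" if "m \<le> J" "state U I" for m U I
    using that
  proof (induction m arbitrary: U I)
    case 0
    then show ?case using G_nonneg[of 0 U] by simp
  next
    case (Suc m)
    show ?case
    proof (cases "good (J - Suc m) U")
      case True
      have "1 - G (Suc m) U \<le> 1 - step (J - Suc m) U I (\<lambda>U I. G m U)"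
        using super[of m U I] Suc.prems True by simp
      also have "\<dots> = step (J - Suc m) U I (\<lambda>U I. 1 + (-1) * G m U)"
        unfolding step_add step_cmult step_const by simp
      also have "\<dots> \<le> step (J - Suc m) U I (\<lambda>U I. ev m U I (\<lambda>_. 1))"
        using Suc by (intro step_mono_state True) auto
      finally show ?thesis using True by simp
    next
      case False
      \<comment> \<open>At a bad state the term of a violating vertex alone is at least 1, which
        covers the loss of the entire run.\<close>
      then obtain w where w: "w \<in> V" "Y * s (J - Suc m) < card (N w \<inter> U)" by (auto simp: good_def not_le)
      have "Y \<le> card (U \<inter> N w) / s (J - Suc m)"
        using w(2) s_pos[of "J - Suc m"] by (simp add: field_simps Int_commute)
      then have "k * Y \<le> k * (card (U \<inter> N w) / s (J - Suc m))" using k by (rule mult_left_mono)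
      then have "1 \<le> g (Suc m) U w" unfolding g_def one_le_exp_iff by simp
      also have "\<dots> \<le> G (Suc m) U"
        unfolding G_def using w(1) finite_V by (intro member_le_sum) (auto simp: g_def)
      finally show ?thesis using False by simp
    qed
  qed
  from this[of J V "{}"] have "1 - G J V \<le> (\<Sum>I\<in>Pow V. mass I)"
    using sum_mass[of "\<lambda>_. 1"] state_init by simp
  moreover have "G J V \<le> card V * exp (1 - k * Y / 2)"
  proof -
    have "g J V w \<le> exp (1 - k * Y / 2)" if "w \<in> V" for w
    proof -
      have "real (card (V \<inter> N w)) \<le> Y / 2"
        using deg[OF that] N_subset[OF that] by (simp add: Int_absorb1)
      then have "k * card (V \<inter> N w) \<le> k * (Y / 2)" using k by (rule mult_left_mono)
      then show ?thesis using J_pos by (simp add: g_def s_def)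
    qed
    then have "G J V \<le> (\<Sum>w\<in>V. exp (1 - k * Y / 2))" unfolding G_def by (intro sum_mono)
    then show ?thesis by simp
  qed
  ultimately show ?thesis by linarith
qed

lemma power_add_first_order:
  fixes x y :: real
  assumes "0 \<le> x" "0 \<le> y"
  shows "x ^ r + r * y * x ^ (r - 1) \<le> (x + y) ^ r"
proof (induction r)
  case (Suc r)
  have "x ^ Suc r + Suc r * y * x ^ (Suc r - 1) \<le> (x + y) * (x ^ r + r * y * x ^ (r - 1))"
  proof (cases r)
    case (Suc n)
    then show ?thesis using assms by (simp add: algebra_simps)
  qed simp
  also have "\<dots> \<le> (x + y) * (x + y) ^ r" using Suc assms by (intro mult_left_mono) auto
  finally show ?case by simp
qed simp

text \<open>A step picks at most one vertex, and any given one with probability at most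
  \<open>c\<close>. Giving each missing vertex of \<open>T\<close> the weight (remaining steps)
  times \<open>c\<close>, one step costs just the first-order part of a binomial expansion.\<close>

lemma ev_superset:
  assumes T: "T \<subseteq> V" and \<sigma>: "0 < \<sigma>" "\<sigma> \<le> s J"
  shows "ev J V {} (\<lambda>I. if T \<subseteq> I then 1 else 0) \<le> (p / \<sigma>) ^ card T"
proof -
  define c where "c = p / (J * \<sigma>)"
  \<comment> \<open>Once a vertex of \<open>T\<close> has left \<open>U\<close> unpicked it can
    never enter \<open>I\<close>, hence the value 0.\<close>
  define G where "G m U I = (if T \<subseteq> I \<union> U then (m * c) ^ card (T - I) else 0)"
    for m :: nat and U I :: "'a set"
  have finT: "finite T" using T finite_V finite_subset by blast
  have c: "0 \<le> c" using p_pos \<sigma> by (simp add: c_def)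
  have "ev J V {} (\<lambda>I. if T \<subseteq> I then 1 else 0) \<le> G J V {}"
  proof (rule ev_le)
    fix m U I assume m: "m < J" and st: "state U I" and good: "good (J - Suc m) U"
    define j where "j = J - Suc m"
    have j: "j < J" "J - Suc m = j" using m by (auto simp: j_def)
    define x where "x = m * c"
    define r where "r = card (T - I)"
    have finU: "finite U" using st finite_V finite_subset by (auto simp: state_def)
    have x: "0 \<le> x" using c by (simp add: x_def)
    have qc: "q j \<le> c"
      using \<sigma> s_antimono[of j J] j p_pos J_pos
      by (auto simp: q_def c_def intro!: divide_left_mono mult_left_mono mult_pos_pos s_pos)
    show "step (J - Suc m) U I (G m) \<le> G (Suc m) U I"
    proof (cases "T \<subseteq> I \<union> U")
      case True
      have IU: "I \<inter> U = {}" using st by (auto simp: state_def)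
      have "step j U I (G m) \<le> step j U I (\<lambda>U' I'. x ^ r + x ^ (r - 1) * card (I' \<inter> (T - I)))"
      proof (rule step_mono)
        fix z assume z: "z \<in> U"
        show "G m (U - {z} - N z) (insert z I) \<le> x ^ r + x ^ (r - 1) * card (insert z I \<inter> (T - I))"
        proof (cases "z \<in> T")
          case True
          have "T - insert z I = (T - I) - {z}" by auto
          then have "card (T - insert z I) = r - 1"
            using True z IU finT unfolding r_def by (subst card_Diff_singleton[symmetric]) auto
          moreover have "insert z I \<inter> (T - I) = {z}" using True z IU by auto
          ultimately show ?thesis using x by (auto simp: G_def x_def)
        next
          case False
          then have "T - insert z I = T - I" by auto
          then show ?thesis using x by (auto simp: G_def x_def r_def)
        qed
      next
        fix w assume "w \<in> U"
        show "G m (U - {w}) I \<le> x ^ r + x ^ (r - 1) * card (I \<inter> (T - I))"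
          using x by (auto simp: G_def x_def r_def)
      next
        show "G m U I \<le> x ^ r + x ^ (r - 1) * card (I \<inter> (T - I))"
          using x by (auto simp: G_def x_def r_def)
      qed (use good j st in \<open>auto simp: state_def\<close>)
      also have "\<dots> = x ^ r + x ^ (r - 1) * step j U I (\<lambda>U' I'. real (card (I' \<inter> (T - I))))"
        unfolding step_add step_cmult step_const ..
      also have "step j U I (\<lambda>U' I'. real (card (I' \<inter> (T - I)))) = q j * r"
      proof -
        have "(\<Sum>z\<in>U. real (card (insert z I \<inter> (T - I)))) = (\<Sum>z\<in>U. if z \<in> T - I then 1 else 0)"
          by (intro sum.cong refl) (auto simp: Int_insert_left)
        also have "\<dots> = card (T - I)"
          using finU True by (subst sum.inter_restrict[symmetric]) (auto intro!: arg_cong[where f = card])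
        finally show ?thesis
          unfolding step_def sum_distrib_left[symmetric] by (simp add: r_def Int_Diff)
      qed
      also have "x ^ r + x ^ (r - 1) * (q j * r) \<le> x ^ r + r * c * x ^ (r - 1)"
      proof -
        have "x ^ (r - 1) * (q j * r) \<le> x ^ (r - 1) * (c * r)"
          using qc x by (intro mult_left_mono mult_right_mono) auto
        then show ?thesis by (simp add: mult_ac)
      qed
      also have "\<dots> \<le> (x + c) ^ r" by (rule power_add_first_order[OF x c])
      also have "\<dots> = G (Suc m) U I" using True by (simp add: G_def r_def x_def algebra_simps)
      finally show ?thesis unfolding j(2) .
    next
      case False
      have "step j U I (G m) \<le> step j U I (\<lambda>U' I'. 0)"
        using good j st False by (intro step_mono) (auto simp: state_def G_def)
      then show ?thesis using False by (simp add: step_const G_def j)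
    qed
  next
    fix U I assume "state U I"
    show "(if T \<subseteq> I then 1 else 0) \<le> G 0 U I"
      by (auto simp: G_def Diff_eq_empty_iff[THEN iffD2])
  qed (use c in \<open>auto simp: G_def state_init\<close>)
  also have "\<dots> = (p / \<sigma>) ^ card T"
    using T J_pos by (simp add: G_def c_def)
  finally show ?thesis .
qed

section \<open>Second moments of degrees into a set\<close>

lemma sum_squares_by_degree:
  assumes "U \<subseteq> V" "good j U"
  shows "(\<Sum>z\<in>U. (card (N z \<inter> (U \<inter> S)))\<^sup>2) \<le> Y\<^sup>2 * card (U \<inter> S)"
proof -
  have finU: "finite U" using assms finite_V finite_subset by blast
  have deg: "card (N z \<inter> B) \<le> Y" if "z \<in> U" "B \<subseteq> U" for z B
  proof -
    have "card (N z \<inter> B) \<le> card (N z \<inter> U)" using finU that by (intro card_mono) auto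
    moreover have "card (N z \<inter> U) \<le> Y * s j" using assms that by (auto simp: good_def)
    moreover have "Y * s j \<le> Y" using Y_pos s_le_1[of j] by simp
    ultimately show ?thesis by linarith
  qed
  have "(\<Sum>z\<in>U. (real (card (N z \<inter> (U \<inter> S))))\<^sup>2) \<le> (\<Sum>z\<in>U. Y * card (N z \<inter> (U \<inter> S)))"
    unfolding power2_eq_square using deg by (intro sum_mono mult_right_mono) auto
  also have "\<dots> = Y * (\<Sum>x\<in>U \<inter> S. card (N x \<inter> U))"
    using sum_card_neighbours[of U "U \<inter> S"] assms(1)
    by (simp add: sum_distrib_left[symmetric] of_nat_sum[symmetric] le_infI1 del: of_nat_sum)
  also have "\<dots> \<le> Y * (\<Sum>x\<in>U \<inter> S. Y)"
    unfolding of_nat_sum using deg Y_pos by (intro mult_left_mono sum_mono) auto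
  finally show ?thesis by (simp add: power2_eq_square mult_ac)
qed

text \<open>The squares count triples of \<open>z\<close> and two of its neighbours
  \<open>x\<close>, \<open>y\<close> in \<open>S\<close>: equal pairs give degrees, distinct pairs
  give codegrees. This beats the bound by degrees when \<open>card S * M\<close> is far below
  \<open>Y\<^sup>2\<close>.\<close>

lemma sum_squares_by_codegree:
  fixes M :: real
  assumes "U \<subseteq> V" "good j U" "S \<subseteq> V"
    and M: "0 \<le> M" and codeg: "\<And>x y. x \<in> V \<Longrightarrow> y \<in> V \<Longrightarrow> x \<noteq> y \<Longrightarrow> card (N x \<inter> N y) \<le> M"
  shows "(\<Sum>z\<in>U. (card (N z \<inter> (U \<inter> S)))\<^sup>2) \<le> (Y + card S * M) * card (U \<inter> S)"
proof -
  define T where "T = U \<inter> S"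
  have finU: "finite U" and finS: "finite S" using assms finite_V finite_subset by blast+
  have finT: "finite T" and TV: "T \<subseteq> V" and TS: "card T \<le> card S"
    using finU finS assms by (auto simp: T_def intro: card_mono)
  have fin: "finite (N x)" if "x \<in> V" for x using N_subset[OF that] finite_V finite_subset by blast
  have "(\<Sum>z\<in>U. (real (card (N z \<inter> T)))\<^sup>2) = (\<Sum>z\<in>U. \<Sum>x\<in>T. if x \<in> N z then real (card (N z \<inter> T)) else 0)"
    using finT by (simp add: sum.If_cases power2_eq_square Int_commute)
  also have "\<dots> = (\<Sum>x\<in>T. \<Sum>z\<in>U. if z \<in> N x then real (card (N z \<inter> T)) else 0)"
    by (subst sum.swap) (intro sum.cong refl, auto dest: N_sym)
  also have "\<dots> = (\<Sum>x\<in>T. \<Sum>z\<in>U \<inter> N x. real (card (N z \<inter> T)))"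
    using finU by (simp add: sum.inter_restrict)
  also have "\<dots> = (\<Sum>x\<in>T. \<Sum>y\<in>T. real (card (N y \<inter> (U \<inter> N x))))"
  proof (rule sum.cong[OF refl])
    fix x
    show "(\<Sum>z\<in>U \<inter> N x. real (card (N z \<inter> T))) = (\<Sum>y\<in>T. real (card (N y \<inter> (U \<inter> N x))))"
      using sum_card_neighbours[of "U \<inter> N x" T] assms(1) TV
      unfolding of_nat_sum[symmetric] by (simp add: le_infI1)
  qed
  also have "\<dots> \<le> (\<Sum>x\<in>T. Y + card S * M)"
  proof (intro sum_mono)
    fix x assume x: "x \<in> T"
    have "(\<Sum>y\<in>T. real (card (N y \<inter> (U \<inter> N x))))
        = card (U \<inter> N x) + (\<Sum>y\<in>T - {x}. real (card (N y \<inter> (U \<inter> N x))))"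
      using finT x by (simp add: sum.remove Int_left_commute[of "N x" U])
    also have "\<dots> \<le> Y + (\<Sum>y\<in>T - {x}. M)"
    proof (intro add_mono sum_mono)
      have "card (U \<inter> N x) \<le> Y * s j" using assms(2) x TV by (auto simp: good_def Int_commute)
      moreover have "Y * s j \<le> Y" using Y_pos s_le_1[of j] by simp
      ultimately show "real (card (U \<inter> N x)) \<le> Y" by linarith
    next
      fix y assume y: "y \<in> T - {x}"
      have "card (N y \<inter> (U \<inter> N x)) \<le> card (N y \<inter> N x)"
        using fin[of y] y TV by (intro card_mono) auto
      then show "real (card (N y \<inter> (U \<inter> N x))) \<le> M"
        using codeg[of y x] x y TV by (smt (verit) DiffE insertCI of_nat_mono subsetD)
    qed
    also have "(\<Sum>y\<in>T - {x}. M) \<le> card S * M"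
    proof -
      have "card (T - {x}) \<le> card S" using TS finT by (meson card_Diff1_le le_trans)
      then show ?thesis using M by (simp add: mult_right_mono)
    qed
    finally show "(\<Sum>y\<in>T. real (card (N y \<inter> (U \<inter> N x)))) \<le> Y + card S * M" by linarith
  qed
  finally show ?thesis by (simp add: T_def mult_ac)
qed

end

section \<open>Explicit moment bounds and the constraints on the parameters\<close>

lemma exp_le_one_plus_double:
  fixes a :: real
  assumes "0 \<le> a" "a \<le> 1" shows "exp a - 1 \<le> 2 * a"
proof -
  have "exp a \<le> 1 + a + a\<^sup>2" by (rule exp_bound[OF assms])
  moreover have "a\<^sup>2 \<le> a" using assms by (simp add: power2_eq_square mult_left_le)
  ultimately show ?thesis by linarith
qed

lemma exp_minus_le_half:
  fixes a :: real
  assumes "0 \<le> a" "a \<le> 1" shows "exp (- a) - 1 \<le> - a / 2"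
proof -
  have "exp (- a) \<le> 1 / (1 + a)"
    using exp_ge_add_one_self[of a] assms by (simp add: exp_minus field_simps)
  also have "\<dots> \<le> 1 - a / 2"
  proof -
    have "a * a \<le> a" using assms by (simp add: mult_left_le)
    then show ?thesis using assms by (simp add: field_simps)
  qed
  finally show ?thesis by simp
qed

text \<open>Apply \<open>ev_exp\<close> with rates \<open>3 * a * p\<close> and
  \<open>- a * p / 4\<close>. The linear parts are at most \<open>2 * a * p\<close> and
  \<open>- a * p / 2\<close>, and the differences are reserved for the second-order term: 72 is 8
  times the square of 3, and 12 is 4 times 3.\<close>

lemma (in neighbourhood_process) mass_exp_moments:
  fixes a \<sigma> Q :: real
  assumes S: "S \<subseteq> V" and a: "0 < a" "a \<le> 1" and \<sigma>: "0 < \<sigma>" "\<sigma> \<le> s J" and Q: "0 \<le> Q"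
    "\<And>j U. U \<subseteq> V \<Longrightarrow> good j U \<Longrightarrow> (\<Sum>z\<in>U. (card (N z \<inter> (U \<inter> S)))\<^sup>2) \<le> Q * card (U \<inter> S)"
    and small: "72 * exp (12 * a * p * Y) * a * p\<^sup>2 * (Q / \<sigma>\<^sup>2 + 2 * Y / \<sigma>) \<le> 1"
  shows "(\<Sum>I\<in>Pow V. mass I * exp (a * card (I \<inter> S))) \<le> exp (3 * a * p * card S)"
    and "(\<Sum>I\<in>Pow V. mass I * exp (- a * card (I \<inter> S))) \<le> exp (- a * p * card S / 4)"
proof -
  define K where "K = exp (12 * a * p * Y)"
  define R where "R = Q / \<sigma>\<^sup>2 + 2 * Y / \<sigma>"
  have R: "0 \<le> R" using Q Y_pos \<sigma> by (simp add: R_def)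
  have ap: "0 < a * p" using a p_pos by simp
  have KR: "K * (a * p\<^sup>2) * R \<le> 1 / 72" using small by (simp add: K_def R_def mult_ac)
  have "a * p * (72 * (K * (a * p\<^sup>2) * R)) \<le> a * p * 1"
    using KR ap by (intro mult_left_mono) auto
  then have quad: "72 * K * a\<^sup>2 * p ^ 3 * R \<le> a * p"
    by (simp add: power2_eq_square power3_eq_cube mult_ac)
  have "ev J V {} (\<lambda>I. exp (a * card (I \<inter> S))) \<le> exp (3 * a * p * card S)"
  proof (rule ev_exp[OF S _ _ \<sigma> Q])
    show "exp (4 * \<bar>3 * a * p\<bar> * Y) \<le> K" using a p_pos by (simp add: K_def abs_mult)
    have "p * (exp a - 1) \<le> p * (2 * a)"
      using p_pos a exp_le_one_plus_double by (intro mult_left_mono) auto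
    moreover have "8 * K * (3 * a * p)\<^sup>2 * p * R = 72 * K * a\<^sup>2 * p ^ 3 * R"
      by (simp add: power2_eq_square power3_eq_cube)
    moreover have "p * (2 * a) = 2 * (a * p)" "3 * a * p = 3 * (a * p)" by simp_all
    ultimately show "p * (exp a - 1) + 8 * K * (3 * a * p)\<^sup>2 * p * (Q / \<sigma>\<^sup>2 + 2 * Y / \<sigma>) \<le> 3 * a * p"
      using quad unfolding R_def by linarith
  qed (use a p_pos in auto)
  then show "(\<Sum>I\<in>Pow V. mass I * exp (a * card (I \<inter> S))) \<le> exp (3 * a * p * card S)"
    by (simp add: sum_mass)
  have "ev J V {} (\<lambda>I. exp (- a * card (I \<inter> S))) \<le> exp (- a * p / 4 * card S)"
  proof (rule ev_exp[OF S _ _ \<sigma> Q])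
    show "exp (4 * \<bar>- a * p / 4\<bar> * Y) \<le> K" using a p_pos Y_pos by (simp add: K_def abs_mult)
    have "p * (exp (- a) - 1) \<le> p * (- a / 2)"
      using p_pos a exp_minus_le_half by (intro mult_left_mono) auto
    moreover define E where "E = 8 * K * (- a * p / 4)\<^sup>2 * p * R"
    have "E = 72 * K * a\<^sup>2 * p ^ 3 * R / 144"
      by (simp add: E_def power2_eq_square power3_eq_cube)
    moreover have "p * (- a / 2) = - (a * p) / 2" by simp
    ultimately have "p * (exp (- a) - 1) + E \<le> - (a * p) / 4" using quad ap by linarith
    then show "p * (exp (- a) - 1) + 8 * K * (- a * p / 4)\<^sup>2 * p * (Q / \<sigma>\<^sup>2 + 2 * Y / \<sigma>) \<le> - a * p / 4"
      by (simp add: E_def R_def)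
  qed (use a p_pos in auto)
  then show "(\<Sum>I\<in>Pow V. mass I * exp (- a * card (I \<inter> S))) \<le> exp (- a * p * card S / 4)"
    by (simp add: sum_mass)
qed

lemma one_minus_power_ge_exp:
  fixes x :: real
  assumes "0 \<le> x" "x \<le> 1 / 2" shows "exp (- 2 * x * m) \<le> (1 - x) ^ m"
proof -
  have "exp (- (2 * x)) \<le> 1 - 2 * x / 2 " using exp_minus_le_half[of "2 * x"] assms by simp
  then have "exp (- 2 * x) ^ m \<le> (1 - x) ^ m" by (intro power_mono) auto
  then show ?thesis by (simp add: exp_of_nat_mult[symmetric] mult_ac)
qed

text \<open>\<open>small_sets\<close> and \<open>all_sets\<close> are the smallness hypothesis of
  \<open>mass_exp_moments\<close>: exponent 1 with the codegree estimate, and exponent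
  \<open>a\<close> with the degree estimate. \<open>degrees\<close> is the one of
  \<open>mass_total_ge\<close> for exponent \<open>20 * L / Y\<close>, whence 3200 as 8 times the
  square of 20. \<open>Y\<close> is twice the degree bound \<open>5 * p * n\<close>.
  \<open>new_vertex\<close> bounds the fresh terms that an attachment adds to the degree and
  codegree sums.\<close>

locale growth_parameters =
  fixes n k :: nat and p L M a \<sigma> Y :: real
  assumes n_ge: "8 \<le> n" and L_def: "L = ln n" and p_pos: "0 < p" and k_ge: "3 \<le> k"
    and M_ge: "4 \<le> M" and a_pos: "0 < a" and a_le: "a \<le> 1"
    and Y_def: "Y = 10 * p * n" and \<sigma>_def: "\<sigma> = exp (- 4 * p * Y)"
    and survive: "1 \<le> Y * \<sigma>"
    and small_sets: "72 * exp (12 * p * Y) * p\<^sup>2 * ((Y + 2 * k * M) / \<sigma>\<^sup>2 + 2 * Y / \<sigma>) \<le> 1"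
    and all_sets: "72 * exp (12 * a * p * Y) * a * p\<^sup>2 * (Y\<^sup>2 / \<sigma>\<^sup>2 + 2 * Y / \<sigma>) \<le> 1"
    and degrees: "3200 * L\<^sup>2 * p * ((Y + Y * M) / \<sigma>\<^sup>2 + 2 * Y / \<sigma>) \<le> Y"
    and k_large: "5 * p * n \<le> 2 * k" "16 * L + 8 \<le> p * (k - 1)"
    and apn: "32 \<le> a * p * n"
    and new_vertex: "exp (- a * p * n) + exp (a * p / 4 - a * p * n / 8)
      + n * exp (15 * p\<^sup>2 * n + 2 * (p / \<sigma>)\<^sup>2 * n - M / 2) \<le> 1 / n\<^sup>2"
begin

lemma Y_pos: "0 < Y" and \<sigma>_pos: "0 < \<sigma>"
  using p_pos n_ge by (auto simp: Y_def \<sigma>_def)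

lemma random_independent_set:
  fixes N :: "'a \<Rightarrow> 'a set"
  assumes V: "finite V" "card V \<le> n" and N: "\<And>w. w \<in> V \<Longrightarrow> N w \<subseteq> V" "\<And>x w. x \<in> N w \<Longrightarrow> w \<in> N x" "\<And>w. w \<notin> N w"
    and deg: "\<And>w. w \<in> V \<Longrightarrow> card (N w) \<le> 5 * p * n"
    and codeg: "\<And>x y. x \<in> V \<Longrightarrow> y \<in> V \<Longrightarrow> x \<noteq> y \<Longrightarrow> card (N x \<inter> N y) \<le> M"
  obtains \<mu> :: "'a set \<Rightarrow> real" where
    "\<And>I. 0 \<le> \<mu> I" "\<And>I. \<mu> I \<noteq> 0 \<Longrightarrow> I \<subseteq> V" "\<And>I z. \<mu> I \<noteq> 0 \<Longrightarrow> z \<in> I \<Longrightarrow> N z \<inter> I = {}"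
    "(\<Sum>I\<in>Pow V. \<mu> I) \<le> 1" "1 - 1 / n\<^sup>2 \<le> (\<Sum>I\<in>Pow V. \<mu> I)"
    "\<And>S. S \<subseteq> V \<Longrightarrow> card S \<le> 2 * k \<Longrightarrow> (\<Sum>I\<in>Pow V. \<mu> I * exp (card (I \<inter> S))) \<le> exp (3 * p * card S)"
    "\<And>S. S \<subseteq> V \<Longrightarrow> card S \<le> 2 * k \<Longrightarrow> (\<Sum>I\<in>Pow V. \<mu> I * exp (- real (card (I \<inter> S)))) \<le> exp (- p * card S / 4)"
    "\<And>S. S \<subseteq> V \<Longrightarrow> (\<Sum>I\<in>Pow V. \<mu> I * exp (a * card (I \<inter> S))) \<le> exp (3 * a * p * card S)"
    "\<And>S. S \<subseteq> V \<Longrightarrow> (\<Sum>I\<in>Pow V. \<mu> I * exp (- a * card (I \<inter> S))) \<le> exp (- a * p * card S / 4)"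
    "\<And>T. T \<subseteq> V \<Longrightarrow> (\<Sum>I\<in>Pow V. \<mu> I * (if T \<subseteq> I then 1 else 0)) \<le> (p / \<sigma>) ^ card T"
proof -
  \<comment> \<open>The time discretisation only has to be fine enough for
    \<open>h \<le> 1 / 2\<close> and \<open>n * h \<le> 1\<close>; no later bound depends on
    \<open>J\<close>.\<close>
  obtain J :: nat where J: "4 * p * Y + 2 * n * p * Y + 1 \<le> J" using real_arch_simple by blast
  have pY: "0 < p * Y" "0 \<le> n * p * Y" using p_pos Y_pos by auto
  then have J_pos: "0 < J" and J1: "4 * p * Y \<le> J" and J2: "2 * n * p * Y \<le> J" using J by auto
  have half: "2 * p * Y / J \<le> 1 / 2" using J1 J_pos by (simp add: field_simps)
  have \<sigma>J: "\<sigma> \<le> (1 - 2 * p * Y / J) ^ J"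
  proof -
    have "0 \<le> 2 * p * Y / J" using p_pos Y_pos by simp
    from one_minus_power_ge_exp[OF this half, of J] show ?thesis using J_pos by (simp add: \<sigma>_def mult_ac)
  qed
  interpret neighbourhood_process V N p Y J
  proof
    have "card V * (2 * p * Y / J) \<le> n * (2 * p * Y / J)"
      using V p_pos Y_pos by (intro mult_right_mono) auto
    also have "\<dots> \<le> 1" using J2 J_pos by (simp add: field_simps)
    finally show "card V * (2 * p * Y / J) \<le> 1" .
    have "Y * \<sigma> \<le> Y * (1 - 2 * p * Y / J) ^ J" using \<sigma>J Y_pos by simp
    then show "1 \<le> Y * (1 - 2 * p * Y / J) ^ J" using survive by linarith
  qed (use V N p_pos Y_pos J_pos half in auto)
  have \<sigma>s: "\<sigma> \<le> s J" using \<sigma>J by (simp add: s_def h_def)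
  have M0: "0 \<le> M" using M_ge by simp
  have L_pos: "0 < L" using n_ge by (simp add: L_def)
  have codegree_squares: "(\<Sum>z\<in>U. (card (N z \<inter> (U \<inter> S)))\<^sup>2) \<le> (Y + c * M) * card (U \<inter> S)"
    if "U \<subseteq> V" "good j U" "S \<subseteq> V" "real (card S) \<le> c" for U S j c
  proof -
    have "(\<Sum>z\<in>U. (card (N z \<inter> (U \<inter> S)))\<^sup>2) \<le> (Y + card S * M) * card (U \<inter> S)"
      using sum_squares_by_codegree[OF that(1-3) M0 codeg] by simp
    also have "\<dots> \<le> (Y + c * M) * card (U \<inter> S)"
      using that(4) M0 by (intro mult_right_mono add_left_mono) auto
    finally show ?thesis .
  qed
  show thesis
  proof (rule that[of mass])
    \<comment> \<open>Then half of \<kappa> times \<open>Y\<close> is \<open>10 * L\<close>, so each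
      vertex causes a loss of at most e n^(-10), leaving ample room for the union over
      \<open>V\<close>.\<close>
    define \<kappa> where "\<kappa> = 20 * L / Y"
    have "1 - card V * exp (1 - \<kappa> * Y / 2) \<le> (\<Sum>I\<in>Pow V. mass I)"
    proof (rule mass_total_ge[OF _ \<sigma>_pos \<sigma>s, of _ "Y + Y * M"])
      show "0 \<le> \<kappa>" "0 \<le> Y + Y * M" using L_pos Y_pos M0 by (auto simp: \<kappa>_def)
      show "(\<Sum>z\<in>U. (card (N z \<inter> (U \<inter> N w)))\<^sup>2) \<le> (Y + Y * M) * card (U \<inter> N w)"
        if "U \<subseteq> V" "good j U" "w \<in> V" for j U w
      proof -
        have "card (N w) \<le> Y" using deg[OF that(3)] p_pos by (simp add: Y_def)
        then show ?thesis using codegree_squares[OF that(1,2) N(1)[OF that(3)]] by simp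
      qed
      have "8 * \<kappa>\<^sup>2 * p * ((Y + Y * M) / \<sigma>\<^sup>2 + 2 * Y / \<sigma>) * Y
          = 3200 * L\<^sup>2 * p * ((Y + Y * M) / \<sigma>\<^sup>2 + 2 * Y / \<sigma>) / Y"
        using Y_pos by (simp add: \<kappa>_def power2_eq_square)
      also have "\<dots> \<le> 1" using degrees Y_pos by simp
      finally show "8 * \<kappa>\<^sup>2 * p * ((Y + Y * M) / \<sigma>\<^sup>2 + 2 * Y / \<sigma>) * Y \<le> 1" .
      show "card (N w) \<le> Y / 2" if "w \<in> V" for w using deg[OF that] by (simp add: Y_def)
    qed
    moreover have "card V * exp (1 - \<kappa> * Y / 2) \<le> 1 / n\<^sup>2"
    proof -
      have "\<kappa> * Y / 2 = 10 * L" using Y_pos by (simp add: \<kappa>_def)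
      moreover have "1 \<le> L"
      proof -
        have "exp 1 \<le> (8::real)" using exp_le by linarith
        then have "1 \<le> ln (8::real)" using ln_ge_iff[of 8 1] by simp
        also have "ln 8 \<le> ln (real n)" using n_ge by simp
        finally show ?thesis by (simp add: L_def)
      qed
      ultimately have "1 - \<kappa> * Y / 2 \<le> - (3 * L)" by linarith
      then have "card V * exp (1 - \<kappa> * Y / 2) \<le> n * exp (- (3 * L))"
        using V by (intro mult_mono) auto
      also have "\<dots> = n * exp (- L) ^ 3" by (simp add: exp_of_nat_mult[symmetric])
      also have "exp (- L) = 1 / n" using n_ge by (simp add: L_def exp_minus inverse_eq_divide)
      also have "n * (1 / n) ^ 3 = 1 / (real n)\<^sup>2"
        using n_ge by (simp add: power2_eq_square power3_eq_cube)
      finally show ?thesis by simp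
    qed
    ultimately show "1 - 1 / n\<^sup>2 \<le> (\<Sum>I\<in>Pow V. mass I)" by linarith
  next
    fix S assume S: "S \<subseteq> V" "card S \<le> 2 * k"
    have sq: "(\<Sum>z\<in>U. (card (N z \<inter> (U \<inter> S)))\<^sup>2) \<le> (Y + 2 * k * M) * card (U \<inter> S)"
      if "U \<subseteq> V" "good j U" for j U
      using codegree_squares[OF that S(1), of "2 * real k"] S(2) by simp
    have Q: "0 \<le> Y + 2 * k * M" using Y_pos M0 by simp
    show "(\<Sum>I\<in>Pow V. mass I * exp (card (I \<inter> S))) \<le> exp (3 * p * card S)"
      using mass_exp_moments(1)[OF S(1) _ _ \<sigma>_pos \<sigma>s Q sq, of 1] small_sets by simp
    show "(\<Sum>I\<in>Pow V. mass I * exp (- real (card (I \<inter> S)))) \<le> exp (- p * card S / 4)"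
      using mass_exp_moments(2)[OF S(1) _ _ \<sigma>_pos \<sigma>s Q sq, of 1] small_sets by simp
  next
    fix S assume S: "S \<subseteq> V"
    show "(\<Sum>I\<in>Pow V. mass I * exp (a * card (I \<inter> S))) \<le> exp (3 * a * p * card S)"
      by (rule mass_exp_moments(1)[OF S a_pos a_le \<sigma>_pos \<sigma>s _ _ all_sets])
        (use sum_squares_by_degree in auto)
    show "(\<Sum>I\<in>Pow V. mass I * exp (- a * card (I \<inter> S))) \<le> exp (- a * p * card S / 4)"
      by (rule mass_exp_moments(2)[OF S a_pos a_le \<sigma>_pos \<sigma>s _ _ all_sets])
        (use sum_squares_by_degree in auto)
  next
    fix T assume "T \<subseteq> V"
    then show "(\<Sum>I\<in>Pow V. mass I * (if T \<subseteq> I then 1 else 0)) \<le> (p / \<sigma>) ^ card T"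
      unfolding sum_mass by (rule ev_superset[OF _ \<sigma>_pos \<sigma>s])
  qed (use mass_nonneg mass_support mass_total_le in auto)
qed

end

section \<open>Attaching a vertex\<close>

text \<open>The inclusion is required for every \<open>w\<close>. Together with symmetry it isolates
  all labels from \<open>i\<close> on, so \<open>i\<close> itself can serve as the fresh
  vertex.\<close>

definition triangle_free_on :: "nat \<Rightarrow> (nat \<Rightarrow> nat set) \<Rightarrow> bool" where
  "triangle_free_on i N \<longleftrightarrow> (\<forall>w. N w \<subseteq> {..<i}) \<and> (\<forall>x w. x \<in> N w \<longrightarrow> w \<in> N x) \<and> (\<forall>w. w \<notin> N w)
     \<and> (\<forall>u v w. v \<in> N u \<longrightarrow> w \<in> N v \<longrightarrow> w \<notin> N u)"

definition independent :: "(nat \<Rightarrow> nat set) \<Rightarrow> nat set \<Rightarrow> bool" where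
  "independent N S \<longleftrightarrow> (\<forall>z\<in>S. N z \<inter> S = {})"

text \<open>Every edge is charged to its larger end, so that the newest vertex \<open>i\<close> adds
  exactly \<open>card (I \<inter> F)\<close> and old charges stay unchanged.\<close>

definition edges :: "(nat \<Rightarrow> nat set) \<Rightarrow> nat set \<Rightarrow> nat" where
  "edges N F = (\<Sum>w\<in>F. card (N w \<inter> F \<inter> {..<w}))"

definition attach :: "(nat \<Rightarrow> nat set) \<Rightarrow> nat \<Rightarrow> nat set \<Rightarrow> nat \<Rightarrow> nat set" where
  "attach N i I w = (if w = i then I else if w \<in> I then insert i (N w) else N w)"

lemma triangle_free_on_empty: "triangle_free_on i N \<Longrightarrow> i \<le> w \<Longrightarrow> N w = {}"
  unfolding triangle_free_on_def by (metis all_not_in_conv lessThan_iff not_less subsetD)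

text \<open>A triangle through \<open>i\<close> would contain two adjacent vertices of
  \<open>I\<close>.\<close>

lemma triangle_free_on_attach:
  assumes N: "triangle_free_on i N" and I: "I \<subseteq> {..<i}" "independent N I"
  shows "triangle_free_on (Suc i) (attach N i I)"
proof -
  have sub: "N w \<subseteq> {..<i}" and sym: "x \<in> N w \<Longrightarrow> w \<in> N x" and irr: "w \<notin> N w"
    and tri: "v \<in> N u \<Longrightarrow> w \<in> N v \<Longrightarrow> w \<notin> N u" for u v w x
    using N unfolding triangle_free_on_def by blast+
  have Ni: "N i = {}" "i \<notin> I" using triangle_free_on_empty[OF N, of i] I by auto
  have mem: "x \<in> attach N i I y \<longleftrightarrow> (y = i \<and> x \<in> I) \<or> (y \<noteq> i \<and> x \<in> N y) \<or> (x = i \<and> y \<in> I)" for x y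
    using Ni by (auto simp: attach_def)
  have ind: "x \<in> N w \<Longrightarrow> x \<in> I \<Longrightarrow> w \<notin> I" for x w using I by (auto simp: independent_def)
  show ?thesis
    unfolding triangle_free_on_def
  proof (intro conjI allI impI)
    show "attach N i I w \<subseteq> {..<Suc i}" for w using sub[of w] I unfolding subset_iff mem by auto
    show "x \<in> attach N i I w \<Longrightarrow> w \<in> attach N i I x" for x w
      using sym[of x w] Ni sub[of w] unfolding mem by auto
    show "w \<notin> attach N i I w" for w using irr[of w] Ni unfolding mem by auto
    fix u v w
    assume vu: "v \<in> attach N i I u" and wv: "w \<in> attach N i I v"
    have Niw: "i \<notin> N y" for y using sub[of y] by auto
    show "w \<notin> attach N i I u"
    proof
      assume wu: "w \<in> attach N i I u"
      consider "u = i" | "v = i" "u \<noteq> i" | "w = i" "u \<noteq> i" "v \<noteq> i" | "u \<noteq> i" "v \<noteq> i" "w \<noteq> i" by blast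
      then show False
      proof cases
        case 1 then show False using vu wv wu ind[of w v] Ni Niw unfolding mem by blast
      next
        case 2 then show False using vu wv wu ind[of w u] Ni Niw unfolding mem by blast
      next
        case 3 then show False using vu wv wu ind[of v u] Ni Niw unfolding mem by blast
      next
        case 4 then show False using vu wv wu tri[of v u w] Niw unfolding mem by blast
      qed
    qed
  qed
qed

lemma attach_Int: "i \<notin> S \<Longrightarrow> w \<noteq> i \<Longrightarrow> attach N i I w \<inter> S = N w \<inter> S"
  by (auto simp: attach_def)

lemma independent_attach: "i \<notin> S \<Longrightarrow> independent (attach N i I) S = independent N S"
proof -
  assume "i \<notin> S"
  then have "z \<in> S \<Longrightarrow> attach N i I z \<inter> S = N z \<inter> S" for z by (intro attach_Int) auto
  then show ?thesis by (simp add: independent_def)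
qed

lemma edges_attach: "i \<notin> F \<Longrightarrow> edges (attach N i I) F = edges N F"
proof -
  assume "i \<notin> F"
  then have "w \<in> F \<Longrightarrow> attach N i I w \<inter> F = N w \<inter> F" for w by (intro attach_Int) auto
  then show ?thesis by (simp add: edges_def)
qed

lemma edges_attach_insert:
  assumes "F \<subseteq> {..<i}" "I \<subseteq> {..<i}"
  shows "edges (attach N i I) (insert i F) = edges N F + card (I \<inter> F)"
proof -
  have fin: "finite F" and i: "i \<notin> F" using assms finite_subset by auto
  have "attach N i I w \<inter> insert i F \<inter> {..<w} = N w \<inter> F \<inter> {..<w}" if "w \<in> F" for w
    using that assms i by (auto simp: attach_def)
  moreover have "attach N i I i \<inter> insert i F \<inter> {..<i} = I \<inter> F"
    using assms by (auto simp: attach_def)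
  ultimately show ?thesis using fin i by (simp add: edges_def)
qed

text \<open>Common bookkeeping for the sums over independent and over dense sets: a set after the
  attachment is an old one, or \<open>i\<close> added to a set from a family \<open>B\<close> of
  admissible extensions.\<close>

lemma sum_new_subsets_le:
  fixes f :: "nat set \<Rightarrow> real"
  assumes "A' \<subseteq> A \<union> insert i ` B" "finite A" "finite B" "\<And>S. 0 \<le> f S"
    "\<And>S. S \<in> A \<union> B \<Longrightarrow> i \<notin> S"
  shows "sum f A' \<le> sum f A + (\<Sum>S\<in>B. f (insert i S))"
proof -
  have "inj_on (insert i) B"
    using assms(5) by (intro inj_onI) (metis UnCI insert_ident)
  then have "(\<Sum>S\<in>B. f (insert i S)) = sum f (insert i ` B)" by (simp add: sum.reindex)
  moreover have "sum f A' \<le> sum f (A \<union> insert i ` B)"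
    using assms by (intro sum_mono2) auto
  moreover have "sum f (A \<union> insert i ` B) = sum f A + sum f (insert i ` B)"
    using assms by (intro sum.union_disjoint) auto
  ultimately show ?thesis by simp
qed

section \<open>The potential and its summands\<close>

context growth_parameters
begin

text \<open>\<open>3 * a * p\<close> per attachment is the growth rate of the exponential moment;
  \<open>- a * p * n\<close> makes the initial term of every vertex tiny.\<close>

definition high_degree :: "nat \<Rightarrow> (nat \<Rightarrow> nat set) \<Rightarrow> real" where
  "high_degree i N = (\<Sum>w<i. exp (a * card (N w) - 3 * a * p * i - a * p * n))"

text \<open>The compensator \<open>a * p * i / 4\<close> counts all times from 0 on, also for late
  vertices: a vertex born at time \<open>i\<close> makes up for the missed attachments by its own
  neighbourhood in \<open>{..<i}\<close>. At time \<open>n\<close> the surplus is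
  \<open>a * p * n / 8\<close>.\<close>

definition low_degree :: "nat \<Rightarrow> (nat \<Rightarrow> nat set) \<Rightarrow> real" where
  "low_degree i N = (\<Sum>w<i. exp (- a * card (N w) + a * p * i / 4 - a * p * n / 8))"

text \<open>A pair gains a common neighbour with probability at most
  \<open>(p / \<sigma>)\<^sup>2\<close>. The growth still to come is prepaid through
  \<open>n - i\<close>, so old pairs do not increase the sum on average.\<close>

definition high_codegree :: "nat \<Rightarrow> (nat \<Rightarrow> nat set) \<Rightarrow> real" where
  "high_codegree i N = (\<Sum>w<i. \<Sum>v<w. exp (card (N w \<inter> N v) + 2 * (p / \<sigma>)\<^sup>2 * (real n - real i) - M / 2))"

text \<open>Enlarging a set of size \<open>s\<close> by one vertex changes the quadratic term by
  \<open>p * s / 4\<close>, the exponent in the probability that the new neighbourhood misses the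
  set; \<open>2 * L\<close> leaves a net factor \<open>1 / n\<^sup>2\<close>.\<close>

definition independent_weight :: "nat \<Rightarrow> (nat \<Rightarrow> nat set) \<Rightarrow> real" where
  "independent_weight i N = (\<Sum>S | S \<subseteq> {..<i} \<and> card S \<le> k \<and> independent N S.
     exp (p * card S * (real (card S) - 1) / 8 - 2 * L * card S))"

text \<open>\<open>6 * p * k\<close> pays for the exponential moment of the number of new edges into
  a set of size at most \<open>2 * k\<close>, and \<open>2 * L\<close> again for the union
  bound.\<close>

definition dense_weight :: "nat \<Rightarrow> (nat \<Rightarrow> nat set) \<Rightarrow> real" where
  "dense_weight i N = (\<Sum>F | F \<subseteq> {..<i} \<and> card F \<le> 2 * k.
     exp (edges N F - (2 * L + 6 * p * k) * card F))"

definition potential :: "nat \<Rightarrow> (nat \<Rightarrow> nat set) \<Rightarrow> real" where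
  "potential i N = high_degree i N + low_degree i N + high_codegree i N
     + independent_weight i N + dense_weight i N"

end

section \<open>Expected change of each summand under a random attachment\<close>

locale random_attachment = growth_parameters +
  fixes i :: nat and N :: "nat \<Rightarrow> nat set" and \<mu> :: "nat set \<Rightarrow> real"
  assumes i_less: "i < n" and N: "triangle_free_on i N" and deg: "\<And>w. w < i \<Longrightarrow> card (N w) \<le> 5 * p * n"
    and nonneg: "\<And>I. 0 \<le> \<mu> I" and total: "(\<Sum>I\<in>Pow {..<i}. \<mu> I) \<le> 1"
    and small_pos: "\<And>S. S \<subseteq> {..<i} \<Longrightarrow> card S \<le> 2 * k \<Longrightarrow>
      (\<Sum>I\<in>Pow {..<i}. \<mu> I * exp (card (I \<inter> S))) \<le> exp (3 * p * card S)"
    and small_neg: "\<And>S. S \<subseteq> {..<i} \<Longrightarrow> card S \<le> 2 * k \<Longrightarrow>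
      (\<Sum>I\<in>Pow {..<i}. \<mu> I * exp (- real (card (I \<inter> S)))) \<le> exp (- p * card S / 4)"
    and all_pos: "\<And>S. S \<subseteq> {..<i} \<Longrightarrow> (\<Sum>I\<in>Pow {..<i}. \<mu> I * exp (a * card (I \<inter> S))) \<le> exp (3 * a * p * card S)"
    and all_neg: "\<And>S. S \<subseteq> {..<i} \<Longrightarrow> (\<Sum>I\<in>Pow {..<i}. \<mu> I * exp (- a * card (I \<inter> S))) \<le> exp (- a * p * card S / 4)"
    and superset: "\<And>T. T \<subseteq> {..<i} \<Longrightarrow> (\<Sum>I\<in>Pow {..<i}. \<mu> I * (if T \<subseteq> I then 1 else 0)) \<le> (p / \<sigma>) ^ card T"
begin

definition avg :: "(nat set \<Rightarrow> real) \<Rightarrow> real" where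
  "avg f = (\<Sum>I\<in>Pow {..<i}. \<mu> I * f I)"

lemma avg_mono: "(\<And>I. I \<subseteq> {..<i} \<Longrightarrow> f I \<le> g I) \<Longrightarrow> avg f \<le> avg g"
  unfolding avg_def using nonneg by (intro sum_mono mult_left_mono) auto

lemma avg_add: "avg (\<lambda>I. f I + g I) = avg f + avg g"
  unfolding avg_def by (simp add: distrib_left sum.distrib)

lemma avg_cmult: "avg (\<lambda>I. c * f I) = c * avg f"
  unfolding avg_def by (simp add: sum_distrib_left mult_ac)

lemma avg_sum: "avg (\<lambda>I. \<Sum>x\<in>A. f x I) = (\<Sum>x\<in>A. avg (f x))"
  unfolding avg_def by (simp add: sum_distrib_left sum.swap[of _ A])

lemma avg_const_le: "0 \<le> c \<Longrightarrow> avg (\<lambda>I. c) \<le> c"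
  using total mult_left_mono[of "sum \<mu> (Pow {..<i})" 1 c]
  unfolding avg_def sum_distrib_right[symmetric] by (simp add: mult.commute)

lemma N_props: "N w \<subseteq> {..<i}" "finite (N w)" "i \<notin> N w"
proof -
  show "N w \<subseteq> {..<i}" using N unfolding triangle_free_on_def by blast
  then show "finite (N w)" "i \<notin> N w" using finite_subset by auto
qed

lemma card_attach:
  assumes "w < i" shows "card (attach N i I w) = card (N w) + card (I \<inter> {w})"
  using assms N_props[of w] by (auto simp: attach_def)

lemma avg_high_degree: "avg (\<lambda>I. high_degree (Suc i) (attach N i I)) \<le> high_degree i N + exp (- a * p * n)"
proof -
  have "avg (\<lambda>I. high_degree (Suc i) (attach N i I)) =
     avg (\<lambda>I. (\<Sum>w<i. exp (a * card (N w) - 3 * a * p * Suc i - a * p * n) * exp (a * card (I \<inter> {w})))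
       + exp (- 3 * a * p * Suc i - a * p * n) * exp (a * card (I \<inter> {..<i})))"
    unfolding avg_def
  proof (intro sum.cong refl arg_cong2[where f = "(*)"])
    fix I assume "I \<in> Pow {..<i}"
    then have "attach N i I i = I \<inter> {..<i}" by (auto simp: attach_def)
    then show "high_degree (Suc i) (attach N i I) =
      (\<Sum>w<i. exp (a * card (N w) - 3 * a * p * Suc i - a * p * n) * exp (a * card (I \<inter> {w})))
       + exp (- 3 * a * p * Suc i - a * p * n) * exp (a * card (I \<inter> {..<i}))"
      unfolding high_degree_def sum.lessThan_Suc
      by (simp add: card_attach exp_add[symmetric] algebra_simps)
  qed
  also have "\<dots> = (\<Sum>w<i. exp (a * card (N w) - 3 * a * p * Suc i - a * p * n) * avg (\<lambda>I. exp (a * card (I \<inter> {w}))))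
       + exp (- 3 * a * p * Suc i - a * p * n) * avg (\<lambda>I. exp (a * card (I \<inter> {..<i})))"
    unfolding avg_add avg_sum avg_cmult ..
  also have "\<dots> \<le> (\<Sum>w<i. exp (a * card (N w) - 3 * a * p * Suc i - a * p * n) * exp (3 * a * p))
       + exp (- 3 * a * p * Suc i - a * p * n) * exp (3 * a * p * i)"
    using all_pos[of "{_}"] all_pos[of "{..<i}"]
    by (intro add_mono sum_mono mult_left_mono) (auto simp: avg_def)
  also have "\<dots> \<le> high_degree i N + exp (- a * p * n)"
    unfolding high_degree_def exp_add[symmetric] using a_pos p_pos
    by (intro add_mono sum_mono) (auto simp: algebra_simps)
  finally show ?thesis .
qed

lemma avg_low_degree:
  "avg (\<lambda>I. low_degree (Suc i) (attach N i I)) \<le> low_degree i N + exp (a * p / 4 - a * p * n / 8)"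
proof -
  have "avg (\<lambda>I. low_degree (Suc i) (attach N i I)) =
     avg (\<lambda>I. (\<Sum>w<i. exp (- a * card (N w) + a * p * Suc i / 4 - a * p * n / 8) * exp (- a * card (I \<inter> {w})))
       + exp (a * p * Suc i / 4 - a * p * n / 8) * exp (- a * card (I \<inter> {..<i})))"
    unfolding avg_def
  proof (intro sum.cong refl arg_cong2[where f = "(*)"])
    fix I assume "I \<in> Pow {..<i}"
    then have "attach N i I i = I \<inter> {..<i}" by (auto simp: attach_def)
    then show "low_degree (Suc i) (attach N i I) =
      (\<Sum>w<i. exp (- a * card (N w) + a * p * Suc i / 4 - a * p * n / 8) * exp (- a * card (I \<inter> {w})))
       + exp (a * p * Suc i / 4 - a * p * n / 8) * exp (- a * card (I \<inter> {..<i}))"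
      unfolding low_degree_def sum.lessThan_Suc
      by (simp add: card_attach exp_add[symmetric] algebra_simps)
  qed
  also have "\<dots> = (\<Sum>w<i. exp (- a * card (N w) + a * p * Suc i / 4 - a * p * n / 8) * avg (\<lambda>I. exp (- a * card (I \<inter> {w}))))
       + exp (a * p * Suc i / 4 - a * p * n / 8) * avg (\<lambda>I. exp (- a * card (I \<inter> {..<i})))"
    unfolding avg_add avg_sum avg_cmult ..
  also have "\<dots> \<le> (\<Sum>w<i. exp (- a * card (N w) + a * p * Suc i / 4 - a * p * n / 8) * exp (- a * p / 4))
       + exp (a * p * Suc i / 4 - a * p * n / 8) * exp (- a * p * i / 4)"
    using all_neg[of "{_}"] all_neg[of "{..<i}"]
    by (intro add_mono sum_mono mult_left_mono) (auto simp: avg_def)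
  also have "\<dots> \<le> low_degree i N + exp (a * p / 4 - a * p * n / 8)"
    unfolding low_degree_def exp_add[symmetric]
    by (intro add_mono sum_mono) (auto simp: algebra_simps add_divide_distrib)
  finally show ?thesis .
qed

lemma avg_high_codegree:
  "avg (\<lambda>I. high_codegree (Suc i) (attach N i I)) \<le>
     high_codegree i N + n * exp (15 * p\<^sup>2 * n + 2 * (p / \<sigma>)\<^sup>2 * n - M / 2)"
proof -
  define x where "x = (p / \<sigma>)\<^sup>2"
  have x: "0 \<le> x" by (simp add: x_def)
  define c where "c w v = exp (card (N w \<inter> N v) + 2 * x * (real n - real (Suc i)) - M / 2)" for w v
  define both where "both v w I = (if {v, w} \<subseteq> I then 1 else 0 :: real)" for v w and I :: "nat set"
  have "avg (\<lambda>I. high_codegree (Suc i) (attach N i I)) \<le>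
     avg (\<lambda>I. (\<Sum>w<i. \<Sum>v<w. c w v * (1 + 2 * both v w I))
       + (\<Sum>v<i. exp (2 * x * n - M / 2) * exp (card (I \<inter> N v))))"
  proof (rule avg_mono)
    fix I assume I: "I \<subseteq> {..<i}"
    have old: "card (attach N i I w \<inter> attach N i I v) = card (N w \<inter> N v) + both v w I" if "w < i" "v < w" for v w
    proof -
      have "attach N i I w \<inter> attach N i I v = (N w \<inter> N v) \<union> (if {v, w} \<subseteq> I then {i} else {})"
        using that N_props(3)[of w] N_props(3)[of v] by (auto simp: attach_def)
      then show ?thesis using N_props(2,3)[of w] by (auto simp: both_def)
    qed
    have new: "attach N i I i \<inter> attach N i I v = I \<inter> N v" if "v < i" for v
      using that I by (auto simp: attach_def)
    have "high_codegree (Suc i) (attach N i I) =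
      (\<Sum>w<i. \<Sum>v<w. exp (card (attach N i I w \<inter> attach N i I v) + 2 * x * (real n - real (Suc i)) - M / 2))
      + (\<Sum>v<i. exp (card (attach N i I i \<inter> attach N i I v) + 2 * x * (real n - real (Suc i)) - M / 2))"
      unfolding high_codegree_def x_def sum.lessThan_Suc[of _ i] ..
    also have "\<dots> \<le> (\<Sum>w<i. \<Sum>v<w. c w v * (1 + 2 * both v w I))
       + (\<Sum>v<i. exp (2 * x * n - M / 2) * exp (card (I \<inter> N v)))"
    proof (intro add_mono sum_mono)
      fix w v assume wv: "w \<in> {..<i}" "v \<in> {..<w}"
      have "exp (card (attach N i I w \<inter> attach N i I v) + 2 * x * (real n - real (Suc i)) - M / 2)
          = c w v * exp (both v w I)"
        using wv by (simp add: old c_def exp_add[symmetric] algebra_simps)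
      \<comment> \<open>\<open>both\<close> is 0 or 1 and e is at most 3, so the exponential can be
        made linear in the indicator.\<close>
      also have "\<dots> \<le> c w v * (1 + 2 * both v w I)"
        using exp_le by (intro mult_left_mono) (auto simp: c_def both_def)
      finally show "exp (card (attach N i I w \<inter> attach N i I v) + 2 * x * (real n - real (Suc i)) - M / 2)
          \<le> c w v * (1 + 2 * both v w I)" .
    next
      fix v assume "v \<in> {..<i}"
      then show "exp (card (attach N i I i \<inter> attach N i I v) + 2 * x * (real n - real (Suc i)) - M / 2)
          \<le> exp (2 * x * n - M / 2) * exp (card (I \<inter> N v))"
        using x by (simp add: new exp_add[symmetric] algebra_simps)
    qed
    finally show "high_codegree (Suc i) (attach N i I) \<le> (\<Sum>w<i. \<Sum>v<w. c w v * (1 + 2 * both v w I))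
       + (\<Sum>v<i. exp (2 * x * n - M / 2) * exp (card (I \<inter> N v)))" .
  qed
  also have "\<dots> = (\<Sum>w<i. \<Sum>v<w. c w v * (avg (\<lambda>_. 1) + 2 * avg (both v w)))
       + (\<Sum>v<i. exp (2 * x * n - M / 2) * avg (\<lambda>I. exp (card (I \<inter> N v))))"
    unfolding avg_add avg_sum avg_cmult ..
  also have "\<dots> \<le> (\<Sum>w<i. \<Sum>v<w. c w v * exp (2 * x))
       + (\<Sum>v<i. exp (2 * x * n - M / 2) * exp (15 * p\<^sup>2 * n))"
  proof (intro add_mono sum_mono mult_left_mono)
    fix w v assume wv: "w \<in> {..<i}" "v \<in> {..<w}"
    have "avg (both v w) \<le> (p / \<sigma>) ^ card {v, w}"
      unfolding avg_def both_def using wv by (intro superset) auto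
    then have "avg (both v w) \<le> x" using wv by (simp add: x_def numeral_2_eq_2)
    then have "avg (\<lambda>_. 1) + 2 * avg (both v w) \<le> 1 + 2 * x" using avg_const_le[of 1] by simp
    also have "\<dots> \<le> exp (2 * x)" by (rule exp_ge_add_one_self)
    finally show "avg (\<lambda>_. 1) + 2 * avg (both v w) \<le> exp (2 * x)" .
  next
    fix v assume v: "v \<in> {..<i}"
    \<comment> \<open>The codegree of the new vertex with \<open>v\<close> counts \<open>I\<close>
      inside a neighbourhood, which is small enough for exponent 1 because
      \<open>5 * p * n \<le> 2 * k\<close>.\<close>
    have "avg (\<lambda>I. exp (card (I \<inter> N v))) \<le> exp (3 * p * card (N v))"
      unfolding avg_def using N_props(1) deg[of v] v k_large(1) by (intro small_pos) auto
    also have "\<dots> \<le> exp (15 * p\<^sup>2 * n)"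
    proof -
      have "3 * p * card (N v) \<le> 3 * p * (5 * p * n)" using deg[of v] v p_pos by (intro mult_left_mono) auto
      then show ?thesis by (simp add: power2_eq_square)
    qed
    finally show "avg (\<lambda>I. exp (card (I \<inter> N v))) \<le> exp (15 * p\<^sup>2 * n)" .
  qed (auto simp: c_def)
  also have "(\<Sum>w<i. \<Sum>v<w. c w v * exp (2 * x)) = high_codegree i N"
    unfolding high_codegree_def c_def x_def[symmetric] exp_add[symmetric] by (simp add: algebra_simps)
  also have "(\<Sum>v<i. exp (2 * x * n - M / 2) * exp (15 * p\<^sup>2 * n)) \<le> n * exp (15 * p\<^sup>2 * n + 2 * x * n - M / 2)"
    unfolding exp_add[symmetric] using i_less by (simp add: algebra_simps)
  finally show ?thesis unfolding x_def by simp
qed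

lemma exp_L: "exp (- 2 * L) = 1 / n\<^sup>2"
proof -
  have "exp (- 2 * L) = exp (- L) ^ 2" by (simp add: exp_of_nat_mult[symmetric])
  also have "exp (- L) = 1 / n" using n_ge by (simp add: L_def exp_minus inverse_eq_divide)
  finally show ?thesis by (simp add: power_divide)
qed

text \<open>\<open>S\<close> can be extended by \<open>i\<close> only if \<open>I\<close> misses
  \<open>S\<close>. That indicator is dominated by \<open>exp (- card (I \<inter> S))\<close>, whose
  mean cancels the quadratic gain, so the extensions weigh on average at most
  \<open>1 / n\<^sup>2\<close> of the old sets.\<close>

lemma avg_independent_weight:
  "avg (\<lambda>I. independent_weight (Suc i) (attach N i I)) \<le> (1 + 1 / n\<^sup>2) * independent_weight i N"
proof -
  define A where "A = {S. S \<subseteq> {..<i} \<and> card S \<le> k \<and> independent N S}"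
  define f where "f S = exp (p * card S * (real (card S) - 1) / 8 - 2 * L * card S)" for S :: "nat set"
  have finA: "finite A" by (auto simp: A_def)
  have "avg (\<lambda>I. independent_weight (Suc i) (attach N i I))
      \<le> avg (\<lambda>I. (\<Sum>S\<in>A. f S * 1 + f S * exp (p * card S / 4 - 2 * L) * exp (- real (card (I \<inter> S)))))"
  proof (rule avg_mono)
    fix I assume I: "I \<subseteq> {..<i}"
    define B where "B = {S \<in> A. I \<inter> S = {}}"
    have "{S. S \<subseteq> {..<Suc i} \<and> card S \<le> k \<and> independent (attach N i I) S} \<subseteq> A \<union> insert i ` B"
    proof
      fix S assume "S \<in> {S. S \<subseteq> {..<Suc i} \<and> card S \<le> k \<and> independent (attach N i I) S}"
      then have S: "S \<subseteq> {..<Suc i}" "card S \<le> k" "independent (attach N i I) S" by auto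
      show "S \<in> A \<union> insert i ` B"
      proof (cases "i \<in> S")
        case False
        then have "S \<subseteq> {..<i}" using S(1) by (auto simp: less_Suc_eq)
        then show ?thesis using S False by (auto simp: A_def independent_attach)
      next
        case True
        define S' where "S' = S - {i}"
        have S': "S = insert i S'" "i \<notin> S'" "S' \<subseteq> {..<i}" using True S(1) by (auto simp: S'_def less_Suc_eq)
        have "independent (attach N i I) S'" using S(3) by (auto simp: independent_def S'_def)
        moreover have "card S' \<le> k" using S(2) by (metis S'_def card_Diff1_le le_trans)
        moreover have "I \<inter> S' = {}" using S(3) True S' by (auto simp: independent_def attach_def)
        ultimately show ?thesis using S' by (auto simp: A_def B_def independent_attach)
      qed
    qed
    then have "independent_weight (Suc i) (attach N i I) \<le> sum f A + (\<Sum>S\<in>B. f (insert i S))"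
      unfolding independent_weight_def f_def[symmetric] using finA
      by (intro sum_new_subsets_le) (auto simp: A_def B_def f_def)
    also have "(\<Sum>S\<in>B. f (insert i S)) = (\<Sum>S\<in>B. f S * exp (p * card S / 4 - 2 * L) * exp (- real (card (I \<inter> S))))"
    proof (rule sum.cong[OF refl])
      fix S assume "S \<in> B"
      then have S: "finite S" "i \<notin> S" "I \<inter> S = {}" by (auto simp: B_def A_def intro: finite_subset)
      then have "card (insert i S) = Suc (card S)" by simp
      then show "f (insert i S) = f S * exp (p * card S / 4 - 2 * L) * exp (- real (card (I \<inter> S)))"
        unfolding f_def S(3) exp_add[symmetric] by (simp add: field_simps)
    qed
    also have "\<dots> \<le> (\<Sum>S\<in>A. f S * exp (p * card S / 4 - 2 * L) * exp (- real (card (I \<inter> S))))"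
      using finA by (intro sum_mono2) (auto simp: B_def f_def)
    finally show "independent_weight (Suc i) (attach N i I) \<le>
        (\<Sum>S\<in>A. f S * 1 + f S * exp (p * card S / 4 - 2 * L) * exp (- real (card (I \<inter> S))))"
      by (simp add: sum.distrib)
  qed
  also have "\<dots> = (\<Sum>S\<in>A. f S * avg (\<lambda>_. 1) + f S * exp (p * card S / 4 - 2 * L) * avg (\<lambda>I. exp (- real (card (I \<inter> S)))))"
    unfolding avg_sum avg_add avg_cmult ..
  also have "\<dots> \<le> (\<Sum>S\<in>A. f S * 1 + f S * exp (p * card S / 4 - 2 * L) * exp (- p * card S / 4))"
    using small_neg by (intro sum_mono add_mono mult_left_mono avg_const_le) (auto simp: f_def A_def avg_def)
  also have "\<dots> = (\<Sum>S\<in>A. (1 + 1 / n\<^sup>2) * f S)"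
    unfolding mult.assoc exp_add[symmetric] exp_L[symmetric] by (simp add: algebra_simps)
  also have "\<dots> = (1 + 1 / n\<^sup>2) * independent_weight i N"
    unfolding independent_weight_def A_def[symmetric] f_def sum_distrib_left ..
  finally show ?thesis .
qed

text \<open>Old sets keep their edges. Extending \<open>F\<close> by \<open>i\<close> multiplies its
  weight by \<open>exp (card (I \<inter> F))\<close>, of mean at most
  \<open>exp (6 * p * k)\<close>, and by the new penalty; \<open>1 / n\<^sup>2\<close> is
  left.\<close>

lemma avg_dense_weight:
  "avg (\<lambda>I. dense_weight (Suc i) (attach N i I)) \<le> (1 + 1 / n\<^sup>2) * dense_weight i N"
proof -
  define A where "A = {F. F \<subseteq> {..<i} \<and> card F \<le> 2 * k}"
  define f where "f N F = exp (edges N F - (2 * L + 6 * p * k) * card F)" for N F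
  have finA: "finite A" by (auto simp: A_def)
  have "avg (\<lambda>I. dense_weight (Suc i) (attach N i I))
      \<le> avg (\<lambda>I. (\<Sum>F\<in>A. f N F * 1 + f N F * exp (- 2 * L - 6 * p * k) * exp (card (I \<inter> F))))"
  proof (rule avg_mono)
    fix I assume I: "I \<subseteq> {..<i}"
    have "{F. F \<subseteq> {..<Suc i} \<and> card F \<le> 2 * k} \<subseteq> A \<union> insert i ` A"
    proof
      fix F assume "F \<in> {F. F \<subseteq> {..<Suc i} \<and> card F \<le> 2 * k}"
      then have F: "F \<subseteq> {..<Suc i}" "card F \<le> 2 * k" by auto
      then have "F - {i} \<in> A"
        using le_trans[OF card_Diff1_le[of F i] F(2)] by (auto simp: A_def less_Suc_eq)
      then show "F \<in> A \<union> insert i ` A"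
        by (cases "i \<in> F") (auto intro: image_eqI[of _ _ "F - {i}"])
    qed
    then have "dense_weight (Suc i) (attach N i I) \<le> sum (f (attach N i I)) A + (\<Sum>F\<in>A. f (attach N i I) (insert i F))"
      unfolding dense_weight_def f_def[symmetric] using finA
      by (intro sum_new_subsets_le) (auto simp: A_def f_def)
    also have "sum (f (attach N i I)) A = sum (f N) A"
    proof (rule sum.cong[OF refl])
      fix F assume "F \<in> A"
      then have "i \<notin> F" by (auto simp: A_def)
      then show "f (attach N i I) F = f N F" by (simp add: f_def edges_attach)
    qed
    also have "(\<Sum>F\<in>A. f (attach N i I) (insert i F)) = (\<Sum>F\<in>A. f N F * exp (- 2 * L - 6 * p * k) * exp (card (I \<inter> F)))"
    proof (rule sum.cong[OF refl])
      fix F assume "F \<in> A"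
      then have F: "finite F" "i \<notin> F" "F \<subseteq> {..<i}" by (auto simp: A_def intro: finite_subset)
      then have "card (insert i F) = Suc (card F)" by simp
      then show "f (attach N i I) (insert i F) = f N F * exp (- 2 * L - 6 * p * k) * exp (card (I \<inter> F))"
        unfolding f_def edges_attach_insert[OF F(3) I] exp_add[symmetric] by (simp add: algebra_simps)
    qed
    finally show "dense_weight (Suc i) (attach N i I) \<le>
        (\<Sum>F\<in>A. f N F * 1 + f N F * exp (- 2 * L - 6 * p * k) * exp (card (I \<inter> F)))"
      by (simp add: sum.distrib)
  qed
  also have "\<dots> = (\<Sum>F\<in>A. f N F * avg (\<lambda>_. 1) + f N F * exp (- 2 * L - 6 * p * k) * avg (\<lambda>I. exp (card (I \<inter> F))))"
    unfolding avg_sum avg_add avg_cmult ..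
  also have "\<dots> \<le> (\<Sum>F\<in>A. f N F * 1 + f N F * exp (- 2 * L - 6 * p * k) * exp (6 * p * k))"
  proof (intro sum_mono add_mono mult_left_mono avg_const_le)
    fix F assume F: "F \<in> A"
    then have "avg (\<lambda>I. exp (card (I \<inter> F))) \<le> exp (3 * p * card F)"
      unfolding avg_def by (intro small_pos) (auto simp: A_def)
    also have "\<dots> \<le> exp (3 * p * (2 * k))"
      using F p_pos by (auto simp: A_def simp del: of_nat_mult of_nat_numeral)
    finally show "avg (\<lambda>I. exp (card (I \<inter> F))) \<le> exp (6 * p * k)" by (simp add: mult_ac)
  qed (auto simp: f_def)
  also have "\<dots> = (\<Sum>F\<in>A. (1 + 1 / n\<^sup>2) * f N F)"
    unfolding mult.assoc exp_add[symmetric] exp_L[symmetric] by (simp add: algebra_simps)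
  also have "\<dots> = (1 + 1 / n\<^sup>2) * dense_weight i N"
    unfolding dense_weight_def A_def[symmetric] f_def sum_distrib_left ..
  finally show ?thesis .
qed

end

section \<open>Growing the graph\<close>

lemma sum_card_inside:
  fixes N :: "nat \<Rightarrow> nat set"
  assumes "finite F" and sym: "\<And>x w. x \<in> N w \<Longrightarrow> w \<in> N x" and irrefl: "\<And>w. w \<notin> N w"
  shows "(\<Sum>w\<in>F. card (N w \<inter> F)) = 2 * edges N F"
proof -
  have "(\<Sum>w\<in>F. card (N w \<inter> F \<inter> {w<..})) = (\<Sum>w\<in>F. \<Sum>x\<in>F. if x \<in> N w \<and> w < x then 1 else 0)"
    using assms(1) by (intro sum.cong refl) (simp add: sum.If_cases Int_def conj_ac)
  also have "\<dots> = (\<Sum>x\<in>F. \<Sum>w\<in>F. if x \<in> N w \<and> w < x then 1 else 0)" by (rule sum.swap)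
  also have "\<dots> = (\<Sum>x\<in>F. \<Sum>w\<in>F. if w \<in> N x \<and> w < x then 1 else 0)"
    using sym by (intro sum.cong refl if_cong) blast+
  also have "\<dots> = edges N F"
    unfolding edges_def using assms(1) by (intro sum.cong refl) (simp add: sum.If_cases Int_def conj_ac)
  finally have above: "(\<Sum>w\<in>F. card (N w \<inter> F \<inter> {w<..})) = edges N F" .
  have "card (N w \<inter> F) = card (N w \<inter> F \<inter> {..<w}) + card (N w \<inter> F \<inter> {w<..})" for w
  proof -
    have "N w \<inter> F = (N w \<inter> F \<inter> {..<w}) \<union> (N w \<inter> F \<inter> {w<..})"
      using irrefl[of w] by (auto simp: not_less_iff_gr_or_eq)
    also have "card \<dots> = card (N w \<inter> F \<inter> {..<w}) + card (N w \<inter> F \<inter> {w<..})"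
      using assms(1) by (intro card_Un_disjoint) auto
    finally show ?thesis .
  qed
  then show ?thesis using above by (simp add: sum.distrib edges_def)
qed

section \<open>What a small potential guarantees\<close>

context growth_parameters
begin

lemma weights_nonneg:
  "0 \<le> high_degree i N" "0 \<le> low_degree i N" "0 \<le> high_codegree i N"
  "0 \<le> independent_weight i N" "0 \<le> dense_weight i N"
  unfolding high_degree_def low_degree_def high_codegree_def independent_weight_def dense_weight_def
  by (auto intro!: sum_nonneg)

text \<open>The empty set is independent and has weight 1. This constant term later turns additive
  errors into multiplicative ones.\<close>

lemma potential_ge_1: "1 \<le> potential i N"
proof -
  have "exp (p * card ({} :: nat set) * (real (card ({} :: nat set)) - 1) / 8 - 2 * L * card ({} :: nat set)) \<le> independent_weight i N"
    unfolding independent_weight_def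
    by (rule member_le_sum[where f = "\<lambda>S. exp (p * card S * (real (card S) - 1) / 8 - 2 * L * card S)"])
      (auto simp: independent_def)
  then show ?thesis using weights_nonneg[of i N] by (simp add: potential_def)
qed

lemma exponent_le_2:
  assumes "exp x \<le> (4::real)" shows "x \<le> 2"
proof (rule ccontr)
  assume "\<not> x \<le> 2"
  then have "exp 2 < exp x" by simp
  moreover have "exp 2 = exp 1 * exp (1::real)" by (simp add: exp_add[symmetric])
  moreover have "2 * 2 \<le> exp 1 * exp (1::real)" using exp_ge_add_one_self[of 1] by (intro mult_mono) auto
  ultimately show False using assms by linarith
qed

lemma degree_le:
  assumes "potential i N \<le> 4" "i \<le> n" "w < i" shows "card (N w) \<le> 5 * p * n"
proof -
  have "exp (a * card (N w) - 3 * a * p * i - a * p * n) \<le> high_degree i N"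
    unfolding high_degree_def using assms(3) by (intro member_le_sum) auto
  also have "\<dots> \<le> 4" using assms(1) weights_nonneg[of i N] unfolding potential_def by linarith
  finally have "a * card (N w) - 3 * a * p * i - a * p * n \<le> 2" by (rule exponent_le_2)
  moreover have "3 * a * p * i \<le> 3 * a * p * n" using assms(2) a_pos p_pos by simp
  ultimately have "a * card (N w) \<le> a * (5 * p * n)" using apn by (simp add: algebra_simps)
  then show ?thesis using a_pos by simp
qed

lemma degree_ge:
  assumes "potential n N \<le> 4" "w < n" shows "p * n / 16 \<le> card (N w)"
proof -
  have "exp (- a * card (N w) + a * p * n / 4 - a * p * n / 8) \<le> low_degree n N"
    unfolding low_degree_def using assms(2) by (intro member_le_sum) auto
  also have "\<dots> \<le> 4" using assms(1) weights_nonneg[of n N] unfolding potential_def by linarith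
  finally have "- a * card (N w) + a * p * n / 4 - a * p * n / 8 \<le> 2" by (rule exponent_le_2)
  \<comment> \<open>The constant 32 in \<open>apn\<close> is exactly what makes the error 2 at most
    \<open>a * p * n / 16\<close>, half of the surplus.\<close>
  then have "a * (p * n / 16) \<le> a * card (N w)" using apn by (simp add: algebra_simps)
  then show ?thesis using a_pos by simp
qed

lemma codegree_le:
  assumes "potential i N \<le> 4" "i \<le> n" "v < i" "w < i" "v \<noteq> w" shows "card (N w \<inter> N v) \<le> M"
  using assms(3-5)
proof (induction v w rule: linorder_wlog)
  case (le v w)
  have "exp (card (N w \<inter> N v) + 2 * (p / \<sigma>)\<^sup>2 * (real n - real i) - M / 2)
      \<le> (\<Sum>v<w. exp (card (N w \<inter> N v) + 2 * (p / \<sigma>)\<^sup>2 * (real n - real i) - M / 2))"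
    using le by (intro member_le_sum) auto
  also have "\<dots> \<le> high_codegree i N"
    unfolding high_codegree_def using le by (intro member_le_sum) (auto intro: sum_nonneg)
  also have "\<dots> \<le> 4" using assms(1) weights_nonneg[of i N] unfolding potential_def by linarith
  finally have "card (N w \<inter> N v) + 2 * (p / \<sigma>)\<^sup>2 * (real n - real i) - M / 2 \<le> 2"
    by (rule exponent_le_2)
  moreover have "0 \<le> 2 * (p / \<sigma>)\<^sup>2 * (real n - real i)" using assms(2) by simp
  ultimately show ?case using M_ge by linarith
next
  case (sym v w)
  then show ?case by (simp add: Int_commute)
qed

lemma independent_less:
  assumes "potential n N \<le> 4" "S \<subseteq> {..<n}" "independent N S" shows "card S < k"
proof (rule ccontr)
  assume "\<not> card S < k"
  then obtain T where T: "T \<subseteq> S" "card T = k" by (meson obtain_subset_with_card_n not_less)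
  have "exp (p * card T * (real (card T) - 1) / 8 - 2 * L * card T) \<le> independent_weight n N"
    unfolding independent_weight_def
    using T assms(2,3) by (intro member_le_sum) (auto simp: independent_def)
  also have "\<dots> \<le> 4" using assms(1) weights_nonneg[of n N] unfolding potential_def by linarith
  finally have "p * k * (real k - 1) / 8 - 2 * L * k \<le> 2" unfolding T(2) by (rule exponent_le_2)
  \<comment> \<open>After division by 8, \<open>16 * L\<close> beats the union-bound term
    \<open>2 * L\<close> and the 8 leaves an exponent of at least \<open>k\<close>, which is more
    than 2.\<close>
  moreover have "k * (16 * L + 8) \<le> k * (p * (real k - 1))"
    using k_large(2) k_ge by (intro mult_left_mono) (auto simp: of_nat_diff)
  then have "k \<le> p * k * (real k - 1) / 8 - 2 * L * k" by (simp add: algebra_simps)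
  ultimately show False using k_ge by linarith
qed

lemma edges_le:
  assumes "potential n N \<le> 4" "F \<subseteq> {..<n}" "card F \<le> 2 * k"
  shows "edges N F \<le> (2 * L + 6 * p * k) * card F + 2"
proof -
  have "exp (edges N F - (2 * L + 6 * p * k) * card F) \<le> dense_weight n N"
    unfolding dense_weight_def using assms(2,3) by (intro member_le_sum) auto
  also have "\<dots> \<le> 4" using assms(1) weights_nonneg[of n N] unfolding potential_def by linarith
  finally have "edges N F - (2 * L + 6 * p * k) * card F \<le> 2" by (rule exponent_le_2)
  then show ?thesis by simp
qed

text \<open>With \<open>u = 1 / n\<^sup>2\<close>, the mean potential is at most
  \<open>1 + 2 * u\<close> times the old one and the total mass is at least \<open>1 - u\<close>. If
  every outcome exceeded the factor \<open>1 + 4 * u\<close>, then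
  \<open>(1 + 4 * u) * (1 - u) \<le> 1 + 2 * u\<close>, which is false for
  \<open>0 < u \<le> 1 / 64\<close>.\<close>

lemma extend:
  assumes i: "i < n" and N: "triangle_free_on i N" and pot: "potential i N \<le> 4"
  shows "\<exists>N'. triangle_free_on (Suc i) N' \<and> potential (Suc i) N' \<le> (1 + 4 / n\<^sup>2) * potential i N"
proof -
  define u where "u = 1 / real (n\<^sup>2)"
  have "64 \<le> real (n\<^sup>2)" using power_mono[of 8 n 2] n_ge by (simp flip: of_nat_power)
  then have u: "0 < u" "u \<le> 1 / 64" using n_ge unfolding u_def by (simp_all add: divide_le_eq)
  have N_props: "N w \<subseteq> {..<i}" "w \<notin> N w" "x \<in> N w \<Longrightarrow> w \<in> N x" for x w
    using N unfolding triangle_free_on_def by blast+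
  have deg: "card (N w) \<le> 5 * p * n" if "w < i" for w using degree_le[OF pot _ that] i by simp
  obtain \<mu> :: "nat set \<Rightarrow> real" where \<mu>: "\<And>I. 0 \<le> \<mu> I" "\<And>I. \<mu> I \<noteq> 0 \<Longrightarrow> I \<subseteq> {..<i}"
    "\<And>I z. \<mu> I \<noteq> 0 \<Longrightarrow> z \<in> I \<Longrightarrow> N z \<inter> I = {}"
    "(\<Sum>I\<in>Pow {..<i}. \<mu> I) \<le> 1" "1 - 1 / n\<^sup>2 \<le> (\<Sum>I\<in>Pow {..<i}. \<mu> I)"
    "\<And>S. S \<subseteq> {..<i} \<Longrightarrow> card S \<le> 2 * k \<Longrightarrow>
      (\<Sum>I\<in>Pow {..<i}. \<mu> I * exp (card (I \<inter> S))) \<le> exp (3 * p * card S)"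
    "\<And>S. S \<subseteq> {..<i} \<Longrightarrow> card S \<le> 2 * k \<Longrightarrow>
      (\<Sum>I\<in>Pow {..<i}. \<mu> I * exp (- real (card (I \<inter> S)))) \<le> exp (- p * card S / 4)"
    "\<And>S. S \<subseteq> {..<i} \<Longrightarrow> (\<Sum>I\<in>Pow {..<i}. \<mu> I * exp (a * card (I \<inter> S))) \<le> exp (3 * a * p * card S)"
    "\<And>S. S \<subseteq> {..<i} \<Longrightarrow> (\<Sum>I\<in>Pow {..<i}. \<mu> I * exp (- a * card (I \<inter> S))) \<le> exp (- a * p * card S / 4)"
    "\<And>T. T \<subseteq> {..<i} \<Longrightarrow> (\<Sum>I\<in>Pow {..<i}. \<mu> I * (if T \<subseteq> I then 1 else 0)) \<le> (p / \<sigma>) ^ card T"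
  proof (rule random_independent_set[of "{..<i}" N])
    show "card (N x \<inter> N y) \<le> M" if "x \<in> {..<i}" "y \<in> {..<i}" "x \<noteq> y" for x y
      using codegree_le[OF pot, of y x] that i by simp
  qed (use i N_props deg in auto)
  interpret random_attachment n k p L M a \<sigma> Y i N \<mu>
    by unfold_locales (use i N deg \<mu> in \<open>simp_all\<close>)
  have "avg (\<lambda>I. potential (Suc i) (attach N i I)) \<le> (1 + u) * potential i N + u"
  proof -
    have "avg (\<lambda>I. potential (Suc i) (attach N i I)) \<le> (high_degree i N + exp (- a * p * n))
      + (low_degree i N + exp (a * p / 4 - a * p * n / 8))
      + (high_codegree i N + n * exp (15 * p\<^sup>2 * n + 2 * (p / \<sigma>)\<^sup>2 * n - M / 2))
      + (1 + 1 / n\<^sup>2) * independent_weight i N + (1 + 1 / n\<^sup>2) * dense_weight i N"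
      unfolding potential_def avg_add
      by (intro add_mono avg_high_degree avg_low_degree avg_high_codegree
          avg_independent_weight avg_dense_weight)
    also have "\<dots> \<le> high_degree i N + low_degree i N + high_codegree i N
      + (1 + u) * independent_weight i N + (1 + u) * dense_weight i N + u"
      using new_vertex unfolding u_def by linarith
    also have "\<dots> \<le> (1 + u) * potential i N + u"
    proof -
      have "0 \<le> u * (high_degree i N + low_degree i N + high_codegree i N)"
        using u weights_nonneg[of i N] by simp
      then show ?thesis unfolding potential_def by (simp add: algebra_simps)
    qed
    finally show ?thesis .
  qed
  also have "\<dots> \<le> (1 + 2 * u) * potential i N"
    using mult_left_mono[OF potential_ge_1, of u i N] u by (simp add: algebra_simps)
  finally have upper: "avg (\<lambda>I. potential (Suc i) (attach N i I)) \<le> (1 + 2 * u) * potential i N" .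
  have "\<exists>I. \<mu> I \<noteq> 0 \<and> potential (Suc i) (attach N i I) \<le> (1 + 4 * u) * potential i N"
  proof (rule ccontr)
    assume "\<not> ?thesis"
    then have big: "(1 + 4 * u) * potential i N \<le> potential (Suc i) (attach N i I)" if "\<mu> I \<noteq> 0" for I
      using that by force
    have "(1 + 4 * u) * potential i N * (1 - u) \<le> (1 + 4 * u) * potential i N * (\<Sum>I\<in>Pow {..<i}. \<mu> I)"
      using \<mu>(5) u potential_ge_1[of i N] unfolding u_def[symmetric] by (intro mult_left_mono) auto
    also have "\<dots> = (\<Sum>I\<in>Pow {..<i}. \<mu> I * ((1 + 4 * u) * potential i N))"
      unfolding sum_distrib_right[symmetric] by (rule mult.commute)
    also have "\<dots> \<le> avg (\<lambda>I. potential (Suc i) (attach N i I))"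
      unfolding avg_def
    proof (rule sum_mono)
      fix I show "\<mu> I * ((1 + 4 * u) * potential i N) \<le> \<mu> I * potential (Suc i) (attach N i I)"
        using big[of I] \<mu>(1)[of I] by (cases "\<mu> I = 0") (auto intro: mult_left_mono)
    qed
    also note upper
    finally have "((1 + 4 * u) * (1 - u)) * potential i N \<le> (1 + 2 * u) * potential i N"
      by (simp add: mult_ac)
    then have "(1 + 4 * u) * (1 - u) \<le> 1 + 2 * u" using potential_ge_1[of i N] by simp
    then have "u \<le> 4 * (u * u)" by (simp add: algebra_simps)
    moreover have "u * u \<le> u * (1 / 64)" using u by (intro mult_left_mono) auto
    ultimately show False using u by simp
  qed
  then obtain I where I: "\<mu> I \<noteq> 0" "potential (Suc i) (attach N i I) \<le> (1 + 4 * u) * potential i N" by blast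
  have "triangle_free_on (Suc i) (attach N i I)"
    using \<mu>(2,3)[OF I(1)] by (intro triangle_free_on_attach[OF N]) (auto simp: independent_def)
  then show ?thesis using I(2) by (auto simp: u_def)
qed

text \<open>Over \<open>n\<close> attachments the growth factors multiply to at most exp(4/n), hence
  to at most 2 as \<open>n \<ge> 8\<close>. Starting from 2, the potential therefore never leaves
  the range in which \<open>extend\<close> applies.\<close>

lemma triangle_free_of_small_potential: "\<exists>N. triangle_free_on n N \<and> potential n N \<le> 4"
proof -
  have pow: "2 * (1 + 4 / real (n\<^sup>2)) ^ i \<le> 4" if "i \<le> n" for i
  proof -
    have "(1 + 4 / real (n\<^sup>2)) ^ i \<le> exp (4 / real (n\<^sup>2)) ^ i"
      by (intro power_mono exp_ge_add_one_self) auto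
    also have "\<dots> = exp (i * (4 / real (n\<^sup>2)))" by (rule exp_of_nat_mult[symmetric])
    also have "\<dots> \<le> exp (1 / 2)"
    proof -
      have "8 * i \<le> n * n" using that n_ge by (intro mult_mono) auto
      then have "8 * real i \<le> real (n\<^sup>2)"
        unfolding power2_eq_square by (metis of_nat_le_iff of_nat_mult of_nat_numeral)
      then show ?thesis using n_ge by (simp add: field_simps)
    qed
    also have "\<dots> \<le> 2"
    proof -
      have "exp (1 / 2) * exp (1 / 2) = exp (1::real)" by (simp add: exp_add[symmetric])
      then have "exp (1 / 2) ^ 2 \<le> (2::real) ^ 2" using exp_le by (simp add: power2_eq_square)
      then show ?thesis by (rule power2_le_imp_le) simp
    qed
    finally show ?thesis by simp
  qed
  have "\<exists>N. triangle_free_on i N \<and> potential i N \<le> 2 * (1 + 4 / n\<^sup>2) ^ i" if "i \<le> n" for i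
    using that
  proof (induction i)
    case 0
    have "triangle_free_on 0 (\<lambda>_. {})" by (simp add: triangle_free_on_def)
    moreover have "{S. S \<subseteq> {} \<and> card S \<le> k \<and> independent (\<lambda>_. {}) S} = {{}}"
      "{F. F \<subseteq> {} \<and> card F \<le> 2 * k} = {{} :: nat set}"
      by (auto simp: independent_def)
    \<comment> \<open>Only the empty set contributes, once as an independent set and once as a dense
      set.\<close>
    then have "potential 0 (\<lambda>_. {}) = 2"
      by (simp add: potential_def high_degree_def low_degree_def high_codegree_def
          independent_weight_def dense_weight_def edges_def)
    ultimately show ?case by (intro exI[of _ "\<lambda>_. {}"]) simp
  next
    case (Suc i)
    then obtain N where N: "triangle_free_on i N" "potential i N \<le> 2 * (1 + 4 / n\<^sup>2) ^ i" by auto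
    then have "potential i N \<le> 4" using pow[of i] Suc.prems by simp
    then obtain N' where N': "triangle_free_on (Suc i) N'" "potential (Suc i) N' \<le> (1 + 4 / n\<^sup>2) * potential i N"
      using extend[of i N] Suc.prems N by auto
    have "(1 + 4 / n\<^sup>2) * potential i N \<le> (1 + 4 / n\<^sup>2) * (2 * (1 + 4 / n\<^sup>2) ^ i)"
      using N(2) by (intro mult_left_mono) auto
    then show ?case using N' by (intro exI[of _ N']) (auto simp: mult_ac)
  qed
  from this[of n] pow[of n] show ?thesis by (meson order_refl order_trans)
qed


section \<open>The resulting graph and its induced bipartite subgraphs\<close>

lemma exists_digraph:
  "\<exists>G :: nat pair_pre_digraph. pair_graph G \<and> triangle_free G \<and> verts G = {..<n} \<and>
     p * n / 16 \<le> real (min_degree G) \<and> min_degree G \<le> max_degree G \<and> real (max_degree G) \<le> 5 * p * n \<and>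
     (\<forall>F. induced_subgraph F G \<and> verts F \<noteq> {} \<and> bipartite F \<longrightarrow> real (min_degree F) \<le> 4 * L + 12 * p * k + 4)"
proof -
  obtain N where N: "triangle_free_on n N" and pot: "potential n N \<le> 4"
    using triangle_free_of_small_potential by blast
  have sub: "N w \<subseteq> {..<n}" and sym: "x \<in> N w \<Longrightarrow> w \<in> N x" and irrefl: "w \<notin> N w"
    and tri: "v \<in> N u \<Longrightarrow> w \<in> N v \<Longrightarrow> w \<notin> N u" for u v w x
    using N unfolding triangle_free_on_def by blast+
  define G :: "nat pair_pre_digraph" where "G = \<lparr>pverts = {..<n}, parcs = {(u, v). v \<in> N u}\<rparr>"
  have G: "pverts G = {..<n}" "(u, v) \<in> parcs G \<longleftrightarrow> v \<in> N u" for u v by (auto simp: G_def)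
  have less: "v \<in> N u \<Longrightarrow> u < n \<and> v < n" for u v using sub sym by blast
  have "finite (parcs G)"
    by (rule finite_subset[of _ "{..<n} \<times> {..<n}"]) (use less in \<open>auto simp: G_def\<close>)
  then have graph: "pair_graph G"
  proof unfold_locales
    show "fst e \<in> pverts G" "snd e \<in> pverts G" "fst e \<noteq> snd e" if "e \<in> parcs G" for e
      using that less[of "snd e" "fst e"] irrefl[of "fst e"] by (auto simp: G_def)
    show "symmetric (with_proj G)"
      unfolding symmetric_def with_proj_simps by (rule symI) (use sym in \<open>simp add: G\<close>)
  qed (simp_all add: G)
  have "triangle_free G"
    unfolding triangle_free_def with_proj_simps G using tri sym by blast
  moreover have degree: "out_degree G v = card (N v)" for v
  proof -
    have "out_arcs G v = Pair v ` N v" by (auto simp: out_arcs_def G)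
    then show ?thesis by (simp add: out_degree_def card_image inj_on_def)
  qed
  have fin: "finite (out_degree G ` verts G)" "out_degree G ` verts G \<noteq> {}"
    using n_ge by (auto simp: G lessThan_empty_iff)
  obtain v w where v: "v < n" "min_degree G = card (N v)" and w: "w < n" "max_degree G = card (N w)"
    using Min_in[OF fin] Max_in[OF fin] unfolding min_degree_def max_degree_def by (auto simp: G degree)
  have "min_degree G \<le> max_degree G"
    using Min_le[OF fin(1) Max_in[OF fin]] by (simp add: min_degree_def max_degree_def)
  moreover have "p * n / 16 \<le> real (min_degree G)" using v degree_ge[OF pot, of v] by simp
  moreover have "real (max_degree G) \<le> 5 * p * n" using w degree_le[OF pot, of w] by simp
  moreover have "real (min_degree F) \<le> 4 * L + 12 * p * k + 4"
    if F: "induced_subgraph F G" "verts F \<noteq> {}" "bipartite F" for F :: "(nat, nat \<times> nat) pre_digraph"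
  proof -
    define S where "S = verts F"
    have F_props: "S \<subseteq> {..<n}" "tail F = fst" "head F = snd"
      "arcs F = {e \<in> parcs G. fst e \<in> S \<and> snd e \<in> S}"
      using F(1) by (auto simp: induced_subgraph_def subgraph_def compatible_def S_def G)
    have finS: "finite S" and S_ne: "S \<noteq> {}" using F_props(1) finite_subset F(2) by (auto simp: S_def)
    obtain A B where AB: "S = A \<union> B" "A \<inter> B = {}" "arcs_ends F \<subseteq> A \<times> B \<union> B \<times> A"
      using F(3) by (auto simp: bipartite_def S_def)
    have ends: "(u, v) \<in> arcs_ends F" if "u \<in> S" "v \<in> S" "v \<in> N u" for u v
    proof -
      have "(u, v) \<in> arcs F" using that by (simp add: F_props G)
      then show ?thesis by (force simp: arcs_ends_conv F_props)
    qed
    have "independent N A" "independent N B"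
      unfolding independent_def using ends AB by blast+
    then have "card A < k" "card B < k"
      using F_props(1) AB(1) by (auto intro!: independent_less[OF pot])
    moreover have "card S \<le> card A + card B" unfolding AB(1) by (rule card_Un_le)
    ultimately have "card S \<le> 2 * k" by linarith
    then have edges: "edges N S \<le> (2 * L + 6 * p * k) * card S + 2"
      using edges_le[OF pot F_props(1)] by simp
    have out: "out_degree F v = card (N v \<inter> S)" if "v \<in> S" for v
    proof -
      have "out_arcs F v = Pair v ` (N v \<inter> S)" using that by (auto simp: out_arcs_def F_props G)
      then show ?thesis by (simp add: out_degree_def card_image inj_on_def)
    qed
    have "min_degree F \<le> card (N v \<inter> S)" if "v \<in> S" for v
      unfolding min_degree_def using that finS out[OF that]
      by (metis Min_le S_def finite_imageI imageI)
    then have "(\<Sum>v\<in>S. min_degree F) \<le> (\<Sum>v\<in>S. card (N v \<inter> S))" by (intro sum_mono)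
    also have "\<dots> = 2 * edges N S" by (rule sum_card_inside[OF finS sym irrefl])
    finally have "card S * min_degree F \<le> 2 * edges N S" by simp
    then have "real (card S) * min_degree F \<le> 2 * real (edges N S)"
      by (simp flip: of_nat_mult)
    \<comment> \<open>Twice the additive 2 of \<open>edges_le\<close> is absorbed into the multiple
      of \<open>card S\<close>, as \<open>S\<close> is non-empty.\<close>
    also have "\<dots> \<le> card S * (4 * L + 12 * p * k + 4)"
    proof -
      have "1 \<le> card S" using finS S_ne by (simp add: Suc_leI card_gt_0_iff)
      then show ?thesis using edges by (simp add: algebra_simps)
    qed
    finally show ?thesis using finS S_ne by (simp add: card_gt_0_iff)
  qed
  ultimately show ?thesis using graph G(1) by (intro exI[of _ G]) auto
qed

end

section \<open>Choice of the parameters\<close>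

text \<open>
  Every factor \<open>exp (- O(\<epsilon> ln n))\<close> is absorbed into \<open>n powr (1 / 1000)\<close>; after that the
  parameters enter only through \<open>n powr (-1/2) \<le> p \<le> n powr (-1/2) * ln n\<close>.
\<close>
lemma eventually_growth_parameters:
  fixes \<epsilon> :: real
  assumes \<epsilon>: "0 < \<epsilon>" "\<epsilon> \<le> 1 / 40000"
  shows "\<forall>\<^sub>F n in sequentially. \<exists>k M a \<sigma> Y. growth_parameters n k (sqrt (\<epsilon> * ln n / n)) (ln n) M a \<sigma> Y
    \<and> 4 * ln n + 12 * sqrt (\<epsilon> * ln n / n) * k + 4 \<le> 332 * ln n"
proof -
  have "\<forall>\<^sub>F n in sequentially. 1 \<le> \<epsilon> * ln (real n)" using \<epsilon> by real_asymp
  moreover have "\<forall>\<^sub>F n in sequentially. real n powr (-1/2) * ln n \<le> 1" by real_asymp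
  moreover have "\<forall>\<^sub>F n in sequentially. 4 \<le> real n powr (1/10)" by real_asymp
  moreover have "\<forall>\<^sub>F n in sequentially. real n powr (-1/5) \<le> 1" by real_asymp
  moreover have "\<forall>\<^sub>F n in sequentially. 1 \<le> 10 * real n powr (1/2) * real n powr (-1/1000)" by real_asymp
  moreover have "\<forall>\<^sub>F n in sequentially. 72 * real n powr (3/1000) * (real n powr (-1/2) * ln n)\<^sup>2 *
      ((10 * (real n powr (1/2) * ln n) + 2 * (27 * (real n powr (1/2) * ln n)) * real n powr (1/10)) * real n powr (2/1000)
       + 20 * (real n powr (1/2) * ln n) * real n powr (1/1000)) \<le> 1"
    by real_asymp
  moreover have "\<forall>\<^sub>F n in sequentially. 72 * real n powr (3/1000) * real n powr (-1/5) * (real n powr (-1/2) * ln n)\<^sup>2 *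
      ((10 * (real n powr (1/2) * ln n))\<^sup>2 * real n powr (2/1000)
       + 20 * (real n powr (1/2) * ln n) * real n powr (1/1000)) \<le> 1"
    by real_asymp
  moreover have "\<forall>\<^sub>F n in sequentially. 3200 * (ln (real n))\<^sup>2 * (real n powr (-1/2) * ln n) *
      ((1 + real n powr (1/10)) * real n powr (2/1000) + 2 * real n powr (1/1000)) \<le> 1"
    by real_asymp
  moreover have "\<forall>\<^sub>F n in sequentially. 32 \<le> real n powr (-1/5) * real n powr (1/2)" by real_asymp
  moreover have "\<forall>\<^sub>F n in sequentially. exp (- (real n powr (-1/5) * real n powr (1/2)))
      + exp (1 - real n powr (-1/5) * real n powr (1/2) / 8)
      + n * exp (ln (real n) + 2 * ((ln n)\<^sup>2 * real n powr (2/1000)) - real n powr (1/10) / 2) \<le> 1 / (real n)\<^sup>2"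
    by real_asymp
  ultimately show ?thesis
    using eventually_ge_at_top[of "8::nat"]
  proof eventually_elim
    case (elim n)
    define x where "x = real n"
    define L where "L = ln x"
    define p where "p = sqrt (\<epsilon> * L / x)"
    define Y where "Y = 10 * p * x"
    define \<sigma> where "\<sigma> = exp (- 4 * p * Y)"
    \<comment> \<open>The quotient is what independent sets require. The 2 covers the loss in
      \<open>k - 1\<close> and ensures \<open>3 \<le> k\<close>; \<open>p * k\<close> remains
      O(\<open>L\<close>).\<close>
    define k where "k = nat \<lceil>(16 * L + 8) / p\<rceil> + 2"
    \<comment> \<open>The power must exceed the prepaid codegree growth, at most
      \<open>2 * L\<^sup>2 * x powr (2/1000)\<close>, while \<open>p\<^sup>2 * k * M\<close> has to
      tend to 0 polynomially.\<close>
    define M where "M = x powr (1/10)"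
    \<comment> \<open>In \<open>all_sets\<close> the product \<open>p\<^sup>2 * Y\<^sup>2\<close> is
      only polylogarithmic, so \<open>a\<close> must decay polynomially; yet
      \<open>a * p * x\<close> is at least \<open>x powr (3/10)\<close>, which makes the fresh
      degree terms negligible.\<close>
    define a where "a = x powr (-1/5)"
    note elim = elim[folded x_def, folded L_def]
    have x: "8 \<le> x" using elim by (simp add: x_def)
    have xpos: "0 < x" using x by simp
    have \<epsilon>L: "1 \<le> \<epsilon> * L" by (rule elim(1))
    have "0 < L" using x by (simp add: L_def)
    then have "\<epsilon> * L \<le> 1 / 40000 * L" using \<epsilon> by (intro mult_right_mono) auto
    then have L: "1 \<le> L" "\<epsilon> * L \<le> L" "\<epsilon> * L \<le> L / 40000" using \<epsilon>L by linarith+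
    have half: "x powr (-1/2) = 1 / sqrt x" "x powr (1/2) = sqrt x"
      using xpos by (simp_all add: powr_half_sqrt powr_minus_divide)
    have p_sqrt: "p = sqrt (\<epsilon> * L) / sqrt x" by (simp add: p_def real_sqrt_divide)
    have "sqrt 1 \<le> sqrt (\<epsilon> * L)" using \<epsilon>L by (rule real_sqrt_le_mono)
    then have s1: "1 \<le> sqrt (\<epsilon> * L)" by simp
    have "\<epsilon> * L \<le> L\<^sup>2" using L mult_right_mono[of 1 L L] by (simp add: power2_eq_square)
    then have s2: "sqrt (\<epsilon> * L) \<le> L" using L by (intro real_le_lsqrt) auto
    have p_lower: "x powr (-1/2) \<le> p" and p_upper: "p \<le> x powr (-1/2) * L"
      unfolding half p_sqrt using s1 s2 xpos by (auto simp: divide_right_mono)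
    have p_pos: "0 < p" using \<epsilon>L xpos by (simp add: p_def)
    have p_le: "p \<le> 1" using p_upper elim(2) by linarith
    have p2: "p\<^sup>2 * x = \<epsilon> * L" using \<epsilon>L xpos by (simp add: p_def)
    have px: "x powr (1/2) \<le> p * x" "p * x \<le> x powr (1/2) * L"
    proof -
      have "p * x = sqrt (\<epsilon> * L) * sqrt x" using xpos by (simp add: p_sqrt real_div_sqrt flip: times_divide_eq_right)
      then show "x powr (1/2) \<le> p * x" "p * x \<le> x powr (1/2) * L"
        using s1 s2 xpos by (auto simp: half mult_right_mono mult.commute)
    qed
    have Y: "10 * x powr (1/2) \<le> Y" "Y \<le> 10 * (x powr (1/2) * L)" "0 < Y"
      using px p_pos xpos by (auto simp: Y_def)
    have powr_exp: "x powr c = exp (c * L)" for c using xpos by (simp add: powr_def L_def)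
    have pY: "p * Y = 10 * (\<epsilon> * L)" using p2 by (simp add: Y_def power2_eq_square mult_ac)
    have \<sigma>: "0 < \<sigma>" "x powr (-1/1000) \<le> \<sigma>" "1 / \<sigma> \<le> x powr (1/1000)"
    proof -
      have eq: "\<sigma> = exp (- (40 * (\<epsilon> * L)))" using pY by (simp add: \<sigma>_def mult.assoc)
      show "0 < \<sigma>" by (simp add: eq)
      \<comment> \<open>The bound \<open>1 / 40000\<close> on \<epsilon> comes from here: 40 times
        it is \<open>1 / 1000\<close>.\<close>
      show "x powr (-1/1000) \<le> \<sigma>" unfolding eq powr_exp exp_le_cancel_iff using L(3) by linarith
      have "1 / \<sigma> = exp (40 * (\<epsilon> * L))" by (simp add: eq exp_minus inverse_eq_divide)
      then show "1 / \<sigma> \<le> x powr (1/1000)" unfolding powr_exp using L(3) by simp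
    qed
    have \<sigma>2: "1 / \<sigma>\<^sup>2 \<le> x powr (2/1000)"
    proof -
      have "(1 / \<sigma>)\<^sup>2 \<le> (x powr (1/1000))\<^sup>2" using \<sigma> by (intro power_mono) auto
      moreover have "(x powr (1/1000))\<^sup>2 = x powr (2/1000)"
        unfolding powr_exp power2_eq_square exp_add[symmetric] by simp
      ultimately show ?thesis by (simp add: power_divide)
    qed
    have K: "exp (12 * p * Y) \<le> x powr (3/1000)"
    proof -
      have "12 * p * Y = 120 * (\<epsilon> * L)" using pY by (simp add: mult.assoc)
      then show ?thesis unfolding powr_exp using L(3) by (simp only: exp_le_cancel_iff)
    qed
    have a: "0 < a" "a \<le> 1" using xpos elim(4) by (simp_all add: a_def)
    have "12 * a * p * Y \<le> 12 * p * Y" using a p_pos Y(3) mult_right_mono[of a 1 "12 * p * Y"] by (simp add: mult_ac)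
    then have Ka: "exp (12 * a * p * Y) \<le> x powr (3/1000)" using K by (meson exp_le_cancel_iff order_trans)
    have k_lower: "(16 * L + 8) / p + 2 \<le> k" and k_upper: "k \<le> (16 * L + 8) / p + 3"
      using L p_pos by (auto simp: k_def) linarith+
    have pk: "p * k \<le> 16 * L + 11"
    proof -
      have "p * k \<le> p * ((16 * L + 8) / p + 3)" using k_upper p_pos by (intro mult_left_mono) auto
      also have "\<dots> = 16 * L + 8 + 3 * p" using p_pos by (simp add: field_simps)
      finally show ?thesis using p_le by linarith
    qed
    have k_x: "k \<le> 27 * (x powr (1/2) * L)"
    proof -
      have "x powr (-1/2) * k \<le> p * k" using p_lower by (intro mult_right_mono) auto
      then have "k / sqrt x \<le> 27 * L" using pk L unfolding half by simp
      then show ?thesis using xpos by (simp add: half field_simps)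
    qed
    have M: "4 \<le> M" using elim(3) by (simp add: M_def)
    have apx: "x powr (-1/5) * x powr (1/2) \<le> a * p * x"
      using px(1) a by (simp add: a_def mult.assoc mult_left_mono)
    have p2_le: "p\<^sup>2 \<le> (x powr (-1/2) * L)\<^sup>2" using p_upper p_pos by (intro power_mono) auto
    have quot: "A / \<sigma>\<^sup>2 + 2 * Y / \<sigma> \<le> B * x powr (2/1000) + 20 * (x powr (1/2) * L) * x powr (1/1000)"
      if "0 \<le> A" "A \<le> B" for A B
    proof (rule add_mono)
      have "A * (1 / \<sigma>\<^sup>2) \<le> B * x powr (2/1000)" using that \<sigma>2 by (intro mult_mono) auto
      then show "A / \<sigma>\<^sup>2 \<le> B * x powr (2/1000)" by simp
      have "2 * Y \<le> 20 * (x powr (1/2) * L)" using Y(2) by linarith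
      then have "2 * Y * (1 / \<sigma>) \<le> 20 * (x powr (1/2) * L) * x powr (1/1000)"
        using \<sigma>(3) by (rule mult_mono) (use \<sigma>(1) L(1) in auto)
      then show "2 * Y / \<sigma> \<le> 20 * (x powr (1/2) * L) * x powr (1/1000)" by simp
    qed
    have "growth_parameters n k p L M a \<sigma> Y"
    proof
      show "8 \<le> n" using x by (simp add: x_def)
      show "L = ln n" by (simp add: L_def x_def)
      have "0 < (16 * L + 8) / p" using L(1) p_pos by simp
      then have "2 < real k" using k_lower by linarith
      then show "3 \<le> k" by simp
      show "Y = 10 * p * n" by (simp add: Y_def x_def)
      show "\<sigma> = exp (- 4 * p * Y)" by (rule \<sigma>_def)
      have "10 * x powr (1/2) * x powr (-1/1000) \<le> Y * \<sigma>" using Y \<sigma> by (intro mult_mono) auto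
      then show "1 \<le> Y * \<sigma>" using elim(5) by linarith
      have "Y + 2 * k * M \<le> 10 * (x powr (1/2) * L) + 2 * (27 * (x powr (1/2) * L)) * x powr (1/10)"
      proof -
        have "2 * k * M \<le> 2 * (27 * (x powr (1/2) * L)) * x powr (1/10)"
          unfolding M_def by (rule mult_right_mono) (use k_x in linarith, simp)
        then show ?thesis using Y(2) by linarith
      qed
      then have "72 * exp (12 * p * Y) * p\<^sup>2 * ((Y + 2 * k * M) / \<sigma>\<^sup>2 + 2 * Y / \<sigma>) \<le>
        72 * x powr (3/1000) * (x powr (-1/2) * L)\<^sup>2 *
        ((10 * (x powr (1/2) * L) + 2 * (27 * (x powr (1/2) * L)) * x powr (1/10)) * x powr (2/1000)
         + 20 * (x powr (1/2) * L) * x powr (1/1000))"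
        using K p2_le Y M \<sigma> by (intro mult_mono quot) auto
      then show "72 * exp (12 * p * Y) * p\<^sup>2 * ((Y + 2 * k * M) / \<sigma>\<^sup>2 + 2 * Y / \<sigma>) \<le> 1"
        using elim(6) by linarith
      have "Y\<^sup>2 \<le> (10 * (x powr (1/2) * L))\<^sup>2" using Y by (intro power_mono) auto
      then have "72 * exp (12 * a * p * Y) * a * p\<^sup>2 * (Y\<^sup>2 / \<sigma>\<^sup>2 + 2 * Y / \<sigma>) \<le>
        72 * x powr (3/1000) * x powr (-1/5) * (x powr (-1/2) * L)\<^sup>2 *
        ((10 * (x powr (1/2) * L))\<^sup>2 * x powr (2/1000) + 20 * (x powr (1/2) * L) * x powr (1/1000))"
        using Ka p2_le Y \<sigma> a by (intro mult_mono quot) (auto simp: a_def)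
      then show "72 * exp (12 * a * p * Y) * a * p\<^sup>2 * (Y\<^sup>2 / \<sigma>\<^sup>2 + 2 * Y / \<sigma>) \<le> 1"
        using elim(7) by linarith
      have "3200 * L\<^sup>2 * p * ((1 + M) * (1 / \<sigma>\<^sup>2) + 2 * (1 / \<sigma>)) \<le>
        3200 * L\<^sup>2 * (x powr (-1/2) * L) * ((1 + x powr (1/10)) * x powr (2/1000) + 2 * x powr (1/1000))"
        using p_upper p_pos \<sigma> \<sigma>2 L by (intro mult_mono add_mono mult_nonneg_nonneg) (auto simp: M_def)
      then have "Y * (3200 * L\<^sup>2 * p * ((1 + M) * (1 / \<sigma>\<^sup>2) + 2 * (1 / \<sigma>))) \<le> Y * 1"
        using elim(8) Y by (intro mult_left_mono) auto
      then show "3200 * L\<^sup>2 * p * ((Y + Y * M) / \<sigma>\<^sup>2 + 2 * Y / \<sigma>) \<le> Y"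
        by (simp add: algebra_simps add_divide_distrib)
      show "5 * p * n \<le> 2 * k"
      proof -
        have "p * (5 * p * x) = 5 * (\<epsilon> * L)" using p2 by (simp add: power2_eq_square mult_ac)
        also have "\<dots> \<le> 5 * L" using L(2) by (intro mult_left_mono) auto
        also have "\<dots> \<le> 2 * (16 * L + 8)" using L(1) by simp
        also have "\<dots> = p * (2 * ((16 * L + 8) / p))" using p_pos by simp
        also have "\<dots> \<le> p * (2 * real k)"
        proof -
          have "(16 * L + 8) / p \<le> k" using k_lower by linarith
          then show ?thesis by (intro mult_left_mono) (use p_pos in auto)
        qed
        finally show ?thesis using p_pos by (simp add: x_def)
      qed
      show "16 * L + 8 \<le> p * (k - 1)"
      proof -
        have "(16 * L + 8) / p \<le> real (k - 1)" using k_lower by (simp add: k_def)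
        then show ?thesis using p_pos by (simp add: field_simps)
      qed
      show "32 \<le> a * p * n" using apx elim(9) by (simp add: x_def)
      show "exp (- a * p * n) + exp (a * p / 4 - a * p * n / 8)
        + n * exp (15 * p\<^sup>2 * n + 2 * (p / \<sigma>)\<^sup>2 * n - M / 2) \<le> 1 / n\<^sup>2"
      proof -
        have "exp (- a * p * x) \<le> exp (- (x powr (-1/5) * x powr (1/2)))" using apx by simp
        moreover have "exp (a * p / 4 - a * p * x / 8) \<le> exp (1 - x powr (-1/5) * x powr (1/2) / 8)"
        proof -
          have "a * p \<le> 1 * 1" using a p_le p_pos by (intro mult_mono) auto
          then show ?thesis using apx by simp
        qed
        moreover have "x * exp (15 * p\<^sup>2 * x + 2 * (p / \<sigma>)\<^sup>2 * x - M / 2)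
          \<le> x * exp (L + 2 * (L\<^sup>2 * x powr (2/1000)) - x powr (1/10) / 2)"
        proof -
          have "15 * p\<^sup>2 * x = 15 * (\<epsilon> * L)" unfolding p2[symmetric] by simp
          then have "15 * p\<^sup>2 * x \<le> L" using L(1,3) by linarith
          moreover have "(p / \<sigma>)\<^sup>2 * x \<le> L\<^sup>2 * x powr (2/1000)"
          proof -
            have "(p / \<sigma>)\<^sup>2 * x = (\<epsilon> * L) * (1 / \<sigma>\<^sup>2)" using p2 by (simp add: power_divide)
            also have "\<dots> \<le> L\<^sup>2 * x powr (2/1000)"
              using \<open>\<epsilon> * L \<le> L\<^sup>2\<close> \<sigma>2 \<epsilon>L by (intro mult_mono) auto
            finally show ?thesis .
          qed
          ultimately show ?thesis using xpos by (simp add: M_def)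
        qed
        ultimately have "exp (- a * p * x) + exp (a * p / 4 - a * p * x / 8)
            + x * exp (15 * p\<^sup>2 * x + 2 * (p / \<sigma>)\<^sup>2 * x - M / 2) \<le> 1 / x\<^sup>2"
          using elim(10) by linarith
        then show ?thesis by (simp add: x_def)
      qed
    qed (use p_pos M a in auto)
    \<comment> \<open>With \<open>p * k \<le> 16 * L + 11\<close> the left side is at most
      \<open>196 * L + 136\<close>, and \<open>1 \<le> L\<close>.\<close>
    moreover have "4 * L + 12 * p * k + 4 \<le> 332 * L" using pk L by simp
    ultimately show ?case unfolding p_def L_def x_def by blast
  qed
qed

theorem theorem3:
  shows "\<exists>c C C' :: real. c > 0 \<and> C > 0 \<and> C' > 0 \<and>
    (\<forall>\<beta>::real. 0 < \<beta> \<and> \<beta> < 1 / 14 \<longrightarrow>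
      (\<exists>n\<^sub>0::nat. \<forall>n\<ge>n\<^sub>0. \<exists>G :: nat pair_pre_digraph.
        pair_graph G \<and> triangle_free G \<and>
        verts G \<noteq> {} \<and>
        real n / 3 \<le> real (card (verts G)) \<and> card (verts G) \<le> n \<and>
        c * sqrt (\<beta> * real n * ln (real n)) \<le> real (min_degree G) \<and>
        min_degree G \<le> max_degree G \<and>
        real (max_degree G) \<le> C * sqrt (\<beta> * real n * ln (real n)) \<and>
        (\<forall>F. induced_subgraph F G \<and> verts F \<noteq> {} \<and> bipartite F \<longrightarrow>
          real (min_degree F) \<le> C' * ln (real n))))"
proof (rule exI[of _ "1 / 1600"], rule exI[of _ "1 / 20"], rule exI[of _ 332], intro conjI allI impI)
  fix \<beta> :: real
  assume \<beta>: "0 < \<beta> \<and> \<beta> < 1 / 14"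
  \<comment> \<open>The rescaling brings \<epsilon> below \<open>1 / 40000\<close> and divides the
    square root by 100. The degree bounds \<open>p * n / 16\<close> and \<open>5 * p * n\<close>
    thus yield \<open>1 / 1600\<close> and \<open>1 / 20\<close>.\<close>
  define \<epsilon> where "\<epsilon> = \<beta> / 10000"
  have \<epsilon>: "0 < \<epsilon>" "\<epsilon> \<le> 1 / 40000" using \<beta> by (auto simp: \<epsilon>_def)
  obtain n\<^sub>0 where n\<^sub>0: "\<forall>n\<ge>n\<^sub>0. \<exists>k M a \<sigma> Y. growth_parameters n k (sqrt (\<epsilon> * ln (real n) / n)) (ln (real n)) M a \<sigma> Y
      \<and> 4 * ln (real n) + 12 * sqrt (\<epsilon> * ln (real n) / n) * k + 4 \<le> 332 * ln (real n)"
    using eventually_growth_parameters[OF \<epsilon>] unfolding eventually_sequentially by blast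
  show "\<exists>n\<^sub>0::nat. \<forall>n\<ge>n\<^sub>0. \<exists>G :: nat pair_pre_digraph.
        pair_graph G \<and> triangle_free G \<and>
        verts G \<noteq> {} \<and>
        real n / 3 \<le> real (card (verts G)) \<and> card (verts G) \<le> n \<and>
        1 / 1600 * sqrt (\<beta> * real n * ln (real n)) \<le> real (min_degree G) \<and>
        min_degree G \<le> max_degree G \<and>
        real (max_degree G) \<le> 1 / 20 * sqrt (\<beta> * real n * ln (real n)) \<and>
        (\<forall>F. induced_subgraph F G \<and> verts F \<noteq> {} \<and> bipartite F \<longrightarrow>
          real (min_degree F) \<le> 332 * ln (real n))"
  proof (intro exI[of _ n\<^sub>0] allI impI)
    fix n assume "n\<^sub>0 \<le> n"
    define p where "p = sqrt (\<epsilon> * ln (real n) / n)"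
    obtain k M a \<sigma> Y where gp: "growth_parameters n k p (ln (real n)) M a \<sigma> Y"
      and k: "4 * ln (real n) + 12 * p * k + 4 \<le> 332 * ln (real n)"
      using n\<^sub>0 \<open>n\<^sub>0 \<le> n\<close> unfolding p_def by blast
    have n: "8 \<le> n" using gp by (simp add: growth_parameters_def)
    have "p * n = sqrt (\<epsilon> * ln (real n) / n) * sqrt (n * n)" by (simp add: p_def)
    also have "\<dots> = sqrt (\<epsilon> * ln (real n) / n * (n * n))" by (simp only: real_sqrt_mult of_nat_mult)
    also have "\<epsilon> * ln (real n) / n * (n * n) = (1 / 100)\<^sup>2 * (\<beta> * n * ln (real n))"
      using n by (simp add: \<epsilon>_def power2_eq_square)
    also have "sqrt \<dots> = sqrt (\<beta> * n * ln (real n)) / 100" by (simp add: real_sqrt_mult)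
    finally have pn: "p * n = sqrt (\<beta> * n * ln (real n)) / 100" .
    obtain G :: "nat pair_pre_digraph" where G: "pair_graph G" "triangle_free G" "verts G = {..<n}"
      "p * n / 16 \<le> real (min_degree G)" "min_degree G \<le> max_degree G" "real (max_degree G) \<le> 5 * p * n"
      "\<forall>F. induced_subgraph F G \<and> verts F \<noteq> {} \<and> bipartite F \<longrightarrow>
        real (min_degree F) \<le> 4 * ln (real n) + 12 * p * k + 4"
      using growth_parameters.exists_digraph[OF gp] by blast
    have "verts G \<noteq> {}" unfolding G(3) using n by (simp add: lessThan_empty_iff)
    moreover have "real n / 3 \<le> card (verts G)" "card (verts G) \<le> n" unfolding G(3) by simp_all
    moreover have "1 / 1600 * sqrt (\<beta> * n * ln (real n)) \<le> real (min_degree G)" using G(4) pn by simp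
    moreover have "real (max_degree G) \<le> 1 / 20 * sqrt (\<beta> * n * ln (real n))"
      using G(6) pn by (simp add: mult.assoc)
    moreover have "\<forall>F. induced_subgraph F G \<and> verts F \<noteq> {} \<and> bipartite F \<longrightarrow>
        real (min_degree F) \<le> 332 * ln (real n)"
      using G(7) k by (meson order_trans)
    ultimately show "\<exists>G :: nat pair_pre_digraph.
        pair_graph G \<and> triangle_free G \<and>
        verts G \<noteq> {} \<and>
        real n / 3 \<le> real (card (verts G)) \<and> card (verts G) \<le> n \<and>
        1 / 1600 * sqrt (\<beta> * real n * ln (real n)) \<le> real (min_degree G) \<and>
        min_degree G \<le> max_degree G \<and>
        real (max_degree G) \<le> 1 / 20 * sqrt (\<beta> * real n * ln (real n)) \<and>
        (\<forall>F. induced_subgraph F G \<and> verts F \<noteq> {} \<and> bipartite F \<longrightarrow>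
          real (min_degree F) \<le> 332 * ln (real n))"
      using G(1,2,5) by blast
  qed
qed simp_all

end
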